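(* Let $f:\mathbb{R}^d\to\mathbb{R}$ be differentiable, $\mu$-strongly convex with $\mu>0$, and asymmetrically $(L_0,L_1)$-smooth with $L_0>0$, $L_1\ge0$, and let $x^*$ be its minimizer, $f_*:=f(x^* )$. Let $\{x^k\}_{k\ge0}$ be the iterates of AdGD with the modified stepsizes $$\lambda_k=\min\left\{\sqrt{1+\frac{3\theta_{k-1}}{4}}\,\lambda_{k-1},\ \frac{\|x^k-x^{k-1}\|}{4\|\nabla f(x^k)-\nabla f(x^{k-1})\|}\right\},\quad k\ge1.$$ Let $\alpha^*=\frac{73-\sqrt{3281}}{16}$ (so $\alpha^*\approx0.98$) and, for $k\ge1$, $$\Psi_k=\Big(1-\frac{\lambda_k\mu}{4}\Big)\|x^k-x^*\|^2+\frac14\Big(1+(1-\alpha^* )\frac{8\mu}{L_0}\Big)\|x^k-x^{k-1}\|^2+2\lambda_k\theta_k(f(x^{k-1})-f_* ).$$ Let $D>0$ with $D^2:=\|x^1-x^*\|^2+\frac34\|x^1-x^0\|^2+2\lambda_1\theta_1(f(x^0)-f(x^* ))$ and $m:=1+\log_{\sqrt{7/4}}\left\lceil\frac{1+L_1D}{2}\right\rceil$. Then for every $N\ge1$ with $N>\sqrt{2N}(m+1)L_1D$, $$\Psi_{N+1}\le\left(1-\frac{\alpha^*\mu}{8L_0}+\frac{\alpha^*\mu(m+1)L_1D}{4\sqrt{2N}L_0}\right)^N\Psi_1.$$ In particular, for every $N\ge1$ with $N\ge8(m+1)^2L_1^2D^2$, $$\Psi_{N+1}\le\left(1-\frac{\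alpha^*\mu}{16L_0}\right)^N\Psi_1.$$
   Context: $\|\cdot\|$ is the Euclidean norm. A differentiable $f:\mathbb{R}^d\to\mathbb{R}$ is $\mu$-strongly convex if $f(y)\ge f(x)+\langle\nabla f(x),y-x\rangle+\frac\mu2\|x-y\|^2$ for all $x,y\in\mathbb{R}^d$. It is asymmetrically $(L_0,L_1)$-smooth if for all $x,y\in\mathbb{R}^d$ $$\|\nabla f(x)-\nabla f(y)\|\le\big(L_0+L_1\|\nabla f(y)\|\big)\|x-y\|.$$ AdGD (Adaptive Gradient Descent) with stepsize rule for $\lambda_k$: given $x^0\in\mathbb{R}^d$, $\lambda_0>0$, $\theta_0=+\infty$, set $x^1=x^0-\lambda_0\nabla f(x^0)$ and for $k=1,2,\ldots$ compute $\lambda_k$ by the given rule, then $x^{k+1}=x^k-\lambda_k\nabla f(x^k)$ and $\theta_k=\frac{\lambda_k}{\lambda_{k-1}}$. Since $\theta_0=+\infty$, $\lambda_1$ equals the second term in the minimum. It is assumed that the method is well defined, i.e. $\nabla f(x^k)\ne\nabla f(x^{k-1})$ for all $k\ge1$. *)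

theory Defs
  imports "HOL-Analysis.Analysis"
begin

definition grad :: "('a::euclidean_space \<Rightarrow> real) \<Rightarrow> 'a \<Rightarrow> 'a" where
  "grad f x = (THE D. GDERIV f x :> D)"

lemma grad_eqI:
  fixes f :: "'a::euclidean_space \<Rightarrow> real"
  assumes "GDERIV f x :> D"
  shows "grad f x = D"
  unfolding grad_def
proof (rule the_equality, rule assms)
  fix E assume "GDERIV f x :> E"
  then have "(\<lambda>h. h \<bullet> E) = (\<lambda>h. h \<bullet> D)"
    using assms has_derivative_unique unfolding gderiv_def by blast
  then show "E = D"
    by (simp add: fun_eq_iff vector_eq_ldot)
qed

lemma gderiv_grad:
  fixes f :: "'a::euclidean_space \<Rightarrow> real"
  assumes "f differentiable (at x)"
  shows "GDERIV f x :> grad f x"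
proof -
  obtain f' where f': "(f has_derivative f') (at x)"
    using assms unfolding differentiable_def by blast
  then have "linear f'"
    by (rule has_derivative_linear)
  then have eq: "f' = (\<lambda>h. h \<bullet> adjoint f' 1)"
    by (auto simp: fun_eq_iff adjoint_works)
  then have "GDERIV f x :> adjoint f' 1"
    using f' eq unfolding gderiv_def by metis
  then show ?thesis
    using grad_eqI[of f x "adjoint f' 1"] by simp
qed

text \<open>The next two notions are meant for functions that are differentiable everywhere;
  differentiability is not part of the definitions and has to be assumed separately.\<close>

definition strongly_convex :: "real \<Rightarrow> ('a::euclidean_space \<Rightarrow> real) \<Rightarrow> bool" where
  "strongly_convex \<mu> f \<longleftrightarrow>
     (\<forall>x y. f y \<ge> f x + grad f x \<bullet> (y - x) + \<mu> / 2 * (norm (x - y))\<^sup>2)"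

definition asym_smooth :: "real \<Rightarrow> real \<Rightarrow> ('a::euclidean_space \<Rightarrow> real) \<Rightarrow> bool" where
  "asym_smooth L0 L1 f \<longleftrightarrow>
     (\<forall>x y. norm (grad f x - grad f y) \<le> (L0 + L1 * norm (grad f y)) * norm (x - y))"

text \<open>The ratio \<open>\<theta>\<^sub>k\<close> of consecutive stepsizes; only used for \<open>k \<ge> 1\<close>.\<close>

definition step_ratio :: "(nat \<Rightarrow> real) \<Rightarrow> nat \<Rightarrow> real" where
  "step_ratio lam k = lam k / lam (k - 1)"

definition local_step :: "('a::euclidean_space \<Rightarrow> real) \<Rightarrow> (nat \<Rightarrow> 'a) \<Rightarrow> nat \<Rightarrow> real" where
  "local_step f x k = norm (x k - x (k - 1)) / (4 * norm (grad f (x k) - grad f (x (k - 1))))"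

text \<open>Iterates \<open>x\<close> and stepsizes \<open>lam\<close> of a well-defined run of AdGD. The convention
  \<open>\<theta>\<^sub>0 = \<infinity>\<close> makes the first term of the minimum infinite for \<open>k = 1\<close>, hence
  \<open>lam 1\<close> is the second term.\<close>

definition adgd_run ::
    "('a::euclidean_space \<Rightarrow> real) \<Rightarrow> (nat \<Rightarrow> 'a) \<Rightarrow> (nat \<Rightarrow> real) \<Rightarrow> bool" where
  "adgd_run f x lam \<longleftrightarrow>
     lam 0 > 0 \<and>
     (\<forall>k. x (Suc k) = x k - lam k *\<^sub>R grad f (x k)) \<and>
     (\<forall>k\<ge>1. grad f (x k) \<noteq> grad f (x (k - 1))) \<and>
     lam 1 = local_step f x 1 \<and>
     (\<forall>k\<ge>2. lam k = min (sqrt (1 + 3 * step_ratio lam (k - 1) / 4) * lam (k - 1))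
                         (local_step f x k))"

definition alpha_star :: real where
  "alpha_star = (73 - sqrt 3281) / 16"

definition Psi :: "('a::euclidean_space \<Rightarrow> real) \<Rightarrow> real \<Rightarrow> real \<Rightarrow> 'a \<Rightarrow> (nat \<Rightarrow> 'a) \<Rightarrow> (nat \<Rightarrow> real)
    \<Rightarrow> nat \<Rightarrow> real" where
  "Psi f \<mu> L0 xs x lam k =
     (1 - lam k * \<mu> / 4) * (norm (x k - xs))\<^sup>2
     + 1 / 4 * (1 + (1 - alpha_star) * (8 * \<mu> / L0)) * (norm (x k - x (k - 1)))\<^sup>2
     + 2 * lam k * step_ratio lam k * (f (x (k - 1)) - f xs)"

end

theory Submission
  imports Defs
begin

text \<open>
  Write \<open>l\<^sub>k\<close> for the stepsizes, \<open>a\<^sub>k = norm (x\<^sub>k - x\<^sub>k\<^sub>-\<^sub>1)\<close> and \<open>s\<^sub>k = max 0 (1 - 8 L0 l\<^sub>k)\<close> for the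
  shortfall of \<open>l\<^sub>k\<close> below \<open>1 / (8 L0)\<close>. The usual AdGD descent inequality, combined with the
  Polyak-Lojasiewicz inequality and the bound on the gradient change along the last step, gives
  \<open>\<Psi>\<^sub>k\<^sub>+\<^sub>1 \<le> (1 - \<alpha>\<^sup>*\<mu>/(8 L0) (1 - 3/4 s\<^sub>k - 1/4 s\<^sub>k\<^sub>+\<^sub>1)) \<Psi>\<^sub>k\<close>; dropping the strong convexity terms it also
  gives \<open>\<Sum> a\<^sub>k\<^sup>2 \<le> 2 D\<^sup>2\<close> and \<open>norm (x\<^sub>k - x\<^sup>*) \<le> D\<close>.

  If \<open>l\<^sub>k\<close> is the local curvature stepsize, asymmetric smoothness at \<open>x\<^sub>k\<close> gives
  \<open>8 L1 a\<^sub>k\<^sub>+\<^sub>1 \<ge> 2 - 8 L0 l\<^sub>k\<close> and \<open>8 L0 l\<^sub>k \<ge> 2 / (1 + L1 D)\<close>; otherwise the stepsize grows, by the factor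
  \<open>sqrt (7/4)\<close> from the second growing step on. So each run of short steps is finite, and its total
  squared shortfall is at most \<open>((m + 1) L1 a\<^sub>k\<^sub>+\<^sub>1)\<^sup>2\<close> for the index \<open>k\<close> at which it starts. Hence
  \<open>\<Sum> s\<^sub>k\<^sup>2 \<le> 2 ((m + 1) L1 D)\<^sup>2\<close>. The Cauchy-Schwarz inequality bounds the sum of the shortfalls, and
  the inequality of arithmetic and geometric means turns the product of the contraction factors into
  the power of their mean.
\<close>

section \<open>Runs of short stepsizes\<close>

abbreviation growth :: real where "growth \<equiv> sqrt (7 / 4)"

lemma growth_bounds: "1 < growth" "growth \<le> 13229 / 10000"
proof -
  show "1 < growth" by (simp add: real_less_rsqrt)
  show "growth \<le> 13229 / 10000" by (rule real_le_lsqrt) (auto simp: power2_eq_square)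
qed

lemma ln_growth_le: "ln growth \<le> 283 / 1000"
proof -
  \<comment> \<open>Among three-decimal numbers, 283/1000 is the least at which the quadratic Taylor
    polynomial of \<open>exp\<close> reaches \<open>growth\<close>.\<close>
  have "growth \<le> 1 + 283 / 1000 + (283 / 1000)\<^sup>2 / 2"
    by (rule real_le_lsqrt) (auto simp: power2_eq_square)
  also have "\<dots> \<le> exp (283 / 1000)"
    using exp_lower_Taylor_quadratic[of "283/1000"] by simp
  finally have "ln growth \<le> ln (exp (283 / 1000))"
    using growth_bounds by (subst ln_le_cancel_iff) auto
  then show ?thesis by simp
qed

text \<open>Rests on \<open>- ln p >= 2 * (1 - p) / (1 + p)\<close>, which is sharp to second order
  at 1; 7067/1000 lies just below 2 / (283/1000).\<close>

lemma log_growth_recip_ge: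
  assumes "0 < p" "p \<le> (1::real)"
  shows "7067 / 1000 * (1 - p) / (1 + p) \<le> - log growth p"
proof -
  define h where "h = (\<lambda>x::real. ln x + 2 * (1 - x) / (1 + x))"
  have "h p \<le> h 1"
  proof (rule DERIV_nonneg_imp_nondecreasing[OF assms(2)])
    fix x :: real assume "p \<le> x" "x \<le> 1"
    then have x: "x > 0" using assms by simp
    have "(h has_real_derivative (1 / x - 4 / (1 + x)\<^sup>2)) (at x)"
      unfolding h_def using x
      by (auto intro!: derivative_eq_intros simp: field_simps power2_eq_square)
    moreover have "1 / x - 4 / (1 + x)\<^sup>2 = (1 - x)\<^sup>2 / (x * (1 + x)\<^sup>2)"
    proof -
      have "1 + x \<noteq> 0" using x by simp
      then show ?thesis using x by (simp add: divide_simps) (simp add: algebra_simps power2_eq_square)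
    qed
    ultimately show "\<exists>y. (h has_real_derivative y) (at x) \<and> y \<ge> 0"
      using x by (intro exI[of _ "1 / x - 4 / (1 + x)\<^sup>2"]) auto
  qed
  then have l: "2 * (1 - p) / (1 + p) \<le> - ln p"
    by (simp add: h_def)
  have nn: "0 \<le> 2 * (1 - p) / (1 + p)" using assms by simp
  have lg: "0 < ln growth" using growth_bounds by simp
  have "7067 / 2000 * ln growth \<le> 7067 / 2000 * (283 / 1000)"
    using ln_growth_le by (intro mult_left_mono) auto
  then have "7067 / 2000 * ln growth \<le> 1" by simp
  then have "7067 / 2000 * (2 * (1 - p) / (1 + p)) * ln growth \<le> 2 * (1 - p) / (1 + p)"
    using mult_right_mono[OF _ nn, of "7067 / 2000 * ln growth" 1] by (simp add: mult_ac)
  also have "\<dots> \<le> - ln p" by (rule l)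
  finally have "7067 / 2000 * (2 * (1 - p) / (1 + p)) \<le> - ln p / ln growth"
    using lg by (subst pos_le_divide_eq)
  moreover have "7067 / 1000 * (1 - p) / (1 + p) = 7067 / 2000 * (2 * (1 - p) / (1 + p))"
    using assms by (simp add: field_simps)
  ultimately show ?thesis by (simp add: log_def)
qed

section \<open>The potential of a run of short stepsizes\<close>

definition shortfall :: "real \<Rightarrow> real" where
  "shortfall p = max 0 (1 - p)"

text \<open>\<open>pot p\<close> bounds the total squared shortfall of the sequence \<open>p, growth * p, growth\<^sup>2 * p, ...\<close>:
  with \<open>2 / (growth - 1)\<close> in place of \<open>6193 / 1000\<close> and without the slack \<open>1 / 50\<close>, the formula
  \<open>W\<close> for \<open>p < 1\<close> would satisfy \<open>W p - W (growth * p) = (1 - p)\<^sup>2\<close>. The slack is needed because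
  \<open>W\<close> is slightly negative on a part of \<open>[1, growth]\<close>.\<close>

definition pot :: "real \<Rightarrow> real" where
  "pot p = (if p < 1 then - log growth p - 6193 / 1000 * (1 - p) + 4 / 3 * (1 - p\<^sup>2) + 1 / 50 else 0)"

text \<open>Below 1 the logarithm dominates the derivative, and at 1 the potential jumps downwards,
  from 1/50 to 0.\<close>

lemma pot_antimono:
  assumes "0 < p" "p \<le> r"
  shows "pot r \<le> pot p"
proof -
  define h where "h = (\<lambda>x::real. - log growth x - 6193 / 1000 * (1 - x) + 4 / 3 * (1 - x\<^sup>2))"
  have mono: "h z \<le> h y" if "0 < y" "y \<le> z" "z \<le> 1" for y z
  proof (rule DERIV_nonpos_imp_nonincreasing[OF that(2)])
    fix x :: real assume "y \<le> x" "x \<le> z"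
    then have x: "x > 0" "x \<le> 1" using that by auto
    have lg: "0 < ln growth" using growth_bounds by simp
    have d: "(h has_real_derivative (- (1 / (ln growth * x)) + 6193 / 1000 - 8 / 3 * x)) (at x)"
      unfolding h_def using x lg growth_bounds
      by (auto intro!: derivative_eq_intros DERIV_log simp: field_simps)
    \<comment> \<open>This quadratic increases on (0, 1] and is below 353/100 at 1, while
      \<open>1 / ln growth\<close> exceeds 353/100.\<close>
    have "x * (6193 / 1000 - 8 / 3 * x) \<le> 353 / 100"
    proof -
      have "0 \<le> (1 - x) * (353 / 100 - 8 / 3 * x)" using x by simp
      moreover have "(1 - x) * (353 / 100 - 8 / 3 * x) + 37 / 10000 * x
          = 353 / 100 - x * (6193 / 1000 - 8 / 3 * x) + x / 30000"
        by (simp add: field_simps)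
      ultimately show ?thesis using x by linarith
    qed
    then have "ln growth * (x * (6193 / 1000 - 8 / 3 * x)) \<le> ln growth * (353 / 100)"
      using lg by (intro mult_left_mono) auto
    also have "\<dots> \<le> 1" using ln_growth_le by simp
    finally have "6193 / 1000 - 8 / 3 * x \<le> 1 / (ln growth * x)"
      using x lg by (simp add: pos_le_divide_eq mult_ac)
    then show "\<exists>d. (h has_real_derivative d) (at x) \<and> d \<le> 0"
      using d by (intro exI[of _ "- (1 / (ln growth * x)) + 6193 / 1000 - 8 / 3 * x"]) auto
  qed
  have h1: "h 1 = 0" by (simp add: h_def)
  show ?thesis
    using mono[of p r] mono[of p 1] h1 assms by (auto simp: pot_def h_def)
qed

lemma pot_nonneg: "0 < p \<Longrightarrow> 0 \<le> pot p"
  using pot_antimono[of p "max 1 p"] by (auto simp: pot_def)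

text \<open>If \<open>growth * p < 1\<close>, the logarithm gains exactly 1, the factor 4/3 inverts
  7/4 - 1, and 6193/1000 * (\<open>growth\<close> - 1) is at most 2, so the gain is at least
  \<open>(1 - p)^2\<close>. If \<open>p < 1 <= growth * p\<close>, the slack 1/50 is spent.\<close>

lemma pot_step:
  assumes p: "0 < p"
  shows "(shortfall p)\<^sup>2 + pot (growth * p) \<le> pot p"
proof (cases "p < 1")
  case False
  moreover have "growth * p \<ge> 1" using False growth_bounds
    by (meson less_le_trans linorder_not_less mult_le_cancel_right1 order_less_imp_le order_trans p)
  ultimately show ?thesis by (simp add: shortfall_def pot_def)
next
  case True
  show ?thesis
  proof (cases "growth * p < 1")
    case qp: True
    have "log growth (growth * p) = 1 + log growth p"
      using growth_bounds p by (subst log_mult) auto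
    moreover have "(growth * p)\<^sup>2 = 7 / 4 * p\<^sup>2" by (simp add: power_mult_distrib)
    moreover have "growth * p \<le> 13229 / 10000 * p"
      using growth_bounds p by (intro mult_right_mono) auto
    moreover have "(1 - p)\<^sup>2 = 1 - 2 * p + p\<^sup>2" by (simp add: power2_eq_square algebra_simps)
    ultimately have "(1 - p)\<^sup>2 + (- log growth (growth * p) - 6193 / 1000 * (1 - growth * p)
        + 4 / 3 * (1 - (growth * p)\<^sup>2) + 1 / 50)
      \<le> - log growth p - 6193 / 1000 * (1 - p) + 4 / 3 * (1 - p\<^sup>2) + 1 / 50"
      using p by argo
    then show ?thesis
      using p True qp by (simp add: pot_def shortfall_def)
  next
    case False
    define z where "z = 1 - p"
    have "1 \<le> 13229 / 10000 * p"
      using False mult_right_mono[of growth "13229/10000" p] growth_bounds p by linarith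
    then have z: "0 < z" "z < 1 / 4" "p = 1 - z" using True by (auto simp: z_def)
    have key: "(1 - p)\<^sup>2 + 6193 / 1000 * (1 - p) - 4 / 3 * (1 - p\<^sup>2) - 1 / 50
        \<le> 7067 / 1000 * (1 - p) / (1 + p)"
    proof (subst pos_le_divide_eq)
      show "0 < 1 + p" using p by simp
      \<comment> \<open>Bernstein form on [0, 1/4] of the claim, with the denominator
        \<open>1 + p = 2 - z\<close> cleared.\<close>
      have "0 \<le> 1 / 4 - z" using z by simp
      then have "0 \<le> z ^ 3" "0 \<le> z\<^sup>2 * (1 / 4 - z)" "0 \<le> z * (1 / 4 - z)\<^sup>2" "0 \<le> (1 / 4 - z) ^ 3"
        using z(1) by simp_all
      then have "0 \<le> 64 / 25 * (1 / 4 - z) ^ 3 + 2846 / 375 * (z * (1 / 4 - z)\<^sup>2)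
          + 2203 / 750 * (z\<^sup>2 * (1 / 4 - z)) + 181 / 750 * z ^ 3"
        by simp
      also have "\<dots> = 7067 / 1000 * z - (z\<^sup>2 + 6193 / 1000 * z - 4 / 3 * (1 - (1 - z)\<^sup>2) - 1 / 50) * (2 - z)"
        by (simp add: field_simps power2_eq_square power3_eq_cube)
      finally show "((1 - p)\<^sup>2 + 6193 / 1000 * (1 - p) - 4 / 3 * (1 - p\<^sup>2) - 1 / 50) * (1 + p)
          \<le> 7067 / 1000 * (1 - p)"
        unfolding z(3) by simp
    qed
    show ?thesis
      using key log_growth_recip_ge[of p] p True False
      by (simp add: pot_def shortfall_def)
  qed
qed

section \<open>The cost of entering a run\<close>

text \<open>The cost of entering a run of short steps is compared with its budget on chords of
  \<open>- log growth\<close> between rational nodes just above \<open>growth powi (- i)\<close>; \<open>t\<close> is the position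
  on the chord. On each chord the gap is a quartic in \<open>t\<close> with positive Bernstein coefficients.\<close>

definition entry_gap :: "real \<Rightarrow> real \<Rightarrow> real \<Rightarrow> real" where
  "entry_gap i p t = (2 - p)\<^sup>2 / 64 * (2 + i + t)\<^sup>2 - (i + t)
     - ((1 - p)\<^sup>2 - 6193 / 1000 * (1 - p) + 4 / 3 * (1 - p\<^sup>2) + 1 / 50)"

text \<open>With \<open>u = - log growth p\<close>, convexity gives \<open>u <= i + t\<close>. Since
  \<open>(2 - p)^2 / 64 * (2 + u)^2 - u\<close> decreases in \<open>u\<close> up to 6, replacing
  \<open>u\<close> by \<open>i + t\<close> only lowers it and leaves
  \<open>entry_gap\<close>.\<close>

lemma entry_cost_on_chord:
  fixes a b p i M :: real
  assumes p: "a \<le> p" "p \<le> b" and ab: "0 < a" "a < b" "b \<le> 1"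
    and la: "- log growth a \<le> i + 1" and lb: "- log growth b \<le> i"
    and M: "2 - log growth p \<le> M" and i: "i \<le> 5"
    and gap: "\<And>t. 0 \<le> t \<Longrightarrow> t \<le> 1 \<Longrightarrow> 0 \<le> entry_gap i (b - (b - a) * t) t"
  shows "(shortfall p)\<^sup>2 + pot p \<le> M\<^sup>2 * (2 - p)\<^sup>2 / 64"
proof -
  define t where "t = (b - p) / (b - a)"
  have t: "0 \<le> t" "t \<le> 1" and pt: "p = b - (b - a) * t"
    using p ab by (auto simp: t_def field_simps)
  define u where "u = - log growth p"
  have "- log growth p \<le> (1 - t) * (- log growth b) + t * (- log growth a)"
  proof -
    have "(1 - t) *\<^sub>R b + t *\<^sub>R a = p" using pt by (simp add: algebra_simps)
    then show ?thesis
      using convex_onD[OF minus_log_convex[of growth], of t b a] growth_bounds t ab by simp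
  qed
  also have "\<dots> \<le> (1 - t) * i + t * (i + 1)"
    using t la lb by (intro add_mono mult_left_mono) auto
  finally have u: "u \<le> i + t" by (simp add: u_def algebra_simps)
  have p0: "0 < p" "p \<le> 1" using p ab by auto
  then have u0: "0 \<le> u" using growth_bounds by (simp add: u_def)
  have "(2 - p)\<^sup>2 \<le> 2\<^sup>2" using p0 by (intro power_mono) auto
  \<comment> \<open>Here \<open>i <= 5\<close> enters: with \<open>t <= 1\<close> and
    \<open>u <= i + t\<close> the sum is at most 16.\<close>
  then have "(2 - p)\<^sup>2 * (4 + i + t + u) \<le> 4 * 16"
    using u u0 t i by (intro mult_mono) auto
  then have "0 \<le> (i + t - u) * (1 - (2 - p)\<^sup>2 * (4 + i + t + u) / 64)"
    using u by simp
  then have "(2 - p)\<^sup>2 / 64 * (2 + i + t)\<^sup>2 - (i + t) \<le> (2 - p)\<^sup>2 / 64 * (2 + u)\<^sup>2 - u"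
    by (simp add: field_simps power2_eq_square)
  moreover have "(2 - p)\<^sup>2 / 64 * (2 + u)\<^sup>2 \<le> (2 - p)\<^sup>2 / 64 * M\<^sup>2"
    using M u0 by (intro mult_left_mono power_mono) (auto simp: u_def)
  moreover have "pot p \<le> u - 6193 / 1000 * (1 - p) + 4 / 3 * (1 - p\<^sup>2) + 1 / 50"
    using p0 u0 by (auto simp: pot_def u_def)
  moreover have "(shortfall p)\<^sup>2 = (1 - p)\<^sup>2" using p0 by (simp add: shortfall_def)
  ultimately show ?thesis
    using gap[OF t] pt unfolding entry_gap_def by (simp add: mult_ac)
qed

text \<open>If a run starts at \<open>p\<close> with \<open>2 - p <= 8 * A\<close>, the right-hand
  side is at most \<open>M^2 * A^2\<close>, the budget of that index. Six chords cover
  \<open>p >= 187/1000\<close>; a discriminant argument covers the rest.\<close>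

lemma entry_cost:
  assumes p: "0 < p" "p \<le> 1" and M: "2 - log growth p \<le> M"
  shows "(shortfall p)\<^sup>2 + pot p \<le> M\<^sup>2 * (2 - p)\<^sup>2 / 64"
proof -
  have node: "- log growth r \<le> real i" if "1 \<le> r * growth ^ i" for r :: real and i
  proof -
    have "0 < growth ^ i" using growth_bounds by simp
    then have r: "0 < r" using that by (metis less_le_trans zero_less_mult_pos2 zero_less_one)
    have "0 \<le> log growth (r * growth ^ i)" using that growth_bounds by simp
    also have "\<dots> = log growth r + real i"
      using r growth_bounds by (simp add: log_mult log_nat_power)
    finally show ?thesis by simp
  qed
  \<comment> \<open>Needed for the odd nodes only, since even powers of \<open>growth\<close> are
    rational.\<close>
  have g: "13228 / 10000 \<le> growth" by (rule real_le_rsqrt) (simp add: power2_eq_square)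
  have n0: "- log growth 1 \<le> 0"
    by simp
  have n1: "- log growth (189 / 250) \<le> 1" using node[of "189 / 250" 1] g by simp
  have n2: "- log growth (4 / 7) \<le> 2" using node[of "4 / 7" 2] by simp
  have n3: "- log growth (54 / 125) \<le> 3" using node[of "54 / 125" 3] g
    by (simp add: power3_eq_cube)
  have n4: "- log growth (16 / 49) \<le> 4" using node[of "16 / 49" 4] 
    by (simp add: power4_eq_xxxx)
  have n5: "- log growth (247 / 1000) \<le> 5" using node[of "247 / 1000" 5] g
    by (simp add: eval_nat_numeral)
  have n6: "- log growth (187 / 1000) \<le> 6" using node[of "187 / 1000" 6]
    by (simp add: eval_nat_numeral)
  have c0: ?thesis if "189 / 250 \<le> p" "p \<le> 1"
  proof (rule entry_cost_on_chord[OF that, where i=0])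
    fix t :: real assume t: "0 \<le> t" "t \<le> 1"
    have "entry_gap 0 (1 - (1 - 189 / 250) * t) t =
      17 / 400 * (1 - t) ^ 4 + 92569 / 750000 * (t * (1 - t) ^ 3) + 277451 / 1500000 * (t\<^sup>2 * (1 - t)\<^sup>2) + 271507 / 1500000 * (t ^ 3 * (1 - t)) + 186943 / 2400000 * t ^ 4"
      unfolding entry_gap_def by (simp add: field_simps eval_nat_numeral)
    then show "0 \<le> entry_gap 0 (1 - (1 - 189 / 250) * t) t"
      using t by simp
  qed (use n0 n1 M in simp_all)
  have c1: ?thesis if "4 / 7 \<le> p" "p \<le> 189 / 250"
  proof (rule entry_cost_on_chord[OF that, where i=1])
    fix t :: real assume t: "0 \<le> t" "t \<le> 1"
    have "entry_gap 1 (189 / 250 - (189 / 250 - 4 / 7) * t) t =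
      186943 / 2400000 * (1 - t) ^ 4 + 1061099 / 5250000 * (t * (1 - t) ^ 3) + 1167403 / 5250000 * (t\<^sup>2 * (1 - t)\<^sup>2) + 5891881 / 36750000 * (t ^ 3 * (1 - t)) + 439 / 7000 * t ^ 4"
      unfolding entry_gap_def by (simp add: field_simps eval_nat_numeral)
    then show "0 \<le> entry_gap 1 (189 / 250 - (189 / 250 - 4 / 7) * t) t"
      using t by simp
  qed (use n1 n2 M in simp_all)
  have c2: ?thesis if "54 / 125 \<le> p" "p \<le> 4 / 7"
  proof (rule entry_cost_on_chord[OF that, where i=2])
    fix t :: real assume t: "0 \<le> t" "t \<le> 1"
    have "entry_gap 2 (4 / 7 - (4 / 7 - 54 / 125) * t) t =
      439 / 7000 * (1 - t) ^ 4 + 1259233 / 9187500 * (t * (1 - t) ^ 3) + 4700923 / 36750000 * (t\<^sup>2 * (1 - t)\<^sup>2) + 68359 / 656250 * (t ^ 3 * (1 - t)) + 19087 / 375000 * t ^ 4"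
      unfolding entry_gap_def by (simp add: field_simps eval_nat_numeral)
    then show "0 \<le> entry_gap 2 (4 / 7 - (4 / 7 - 54 / 125) * t) t"
      using t by simp
  qed (use n2 n3 M in simp_all)
  have c3: ?thesis if "16 / 49 \<le> p" "p \<le> 54 / 125"
  proof (rule entry_cost_on_chord[OF that, where i=3])
    fix t :: real assume t: "0 \<le> t" "t \<le> 1"
    have "entry_gap 3 (54 / 125 - (54 / 125 - 16 / 49) * t) t =
      19087 / 375000 * (1 - t) ^ 4 + 591733 / 4593750 * (t * (1 - t) ^ 3) + 322685467 / 1800750000 * (t\<^sup>2 * (1 - t)\<^sup>2) + 5867003 / 32156250 * (t ^ 3 * (1 - t)) + 195311 / 2401000 * t ^ 4"
      unfolding entry_gap_def by (simp add: field_simps eval_nat_numeral)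
    then show "0 \<le> entry_gap 3 (54 / 125 - (54 / 125 - 16 / 49) * t) t"
      using t by simp
  qed (use n3 n4 M in simp_all)
  have c4: ?thesis if "247 / 1000 \<le> p" "p \<le> 16 / 49"
  proof (rule entry_cost_on_chord[OF that, where i=4])
    fix t :: real assume t: "0 \<le> t" "t \<le> 1"
    have "entry_gap 4 (16 / 49 - (16 / 49 - 247 / 1000) * t) t =
      195311 / 2401000 * (1 - t) ^ 4 + 759590179 / 2401000000 * (t * (1 - t) ^ 3) + 21526471321 / 38416000000 * (t\<^sup>2 * (1 - t)\<^sup>2) + 393833773 / 784000000 * (t ^ 3 * (1 - t)) + 11334689 / 64000000 * t ^ 4"
      unfolding entry_gap_def by (simp add: field_simps eval_nat_numeral)
    then show "0 \<le> entry_gap 4 (16 / 49 - (16 / 49 - 247 / 1000) * t) t"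
      using t by simp
  qed (use n4 n5 M in simp_all)
  have c5: ?thesis if "187 / 1000 \<le> p" "p \<le> 247 / 1000"
  proof (rule entry_cost_on_chord[OF that, where i=5])
    fix t :: real assume t: "0 \<le> t" "t \<le> 1"
    have "entry_gap 5 (247 / 1000 - (247 / 1000 - 187 / 1000) * t) t =
      11334689 / 64000000 * (1 - t) ^ 4 + 25068661 / 32000000 * (t * (1 - t) ^ 3) + 88675081 / 64000000 * (t\<^sup>2 * (1 - t)\<^sup>2) + 4533607 / 4000000 * (t ^ 3 * (1 - t)) + 354201 / 1000000 * t ^ 4"
      unfolding entry_gap_def by (simp add: field_simps eval_nat_numeral)
    then show "0 \<le> entry_gap 5 (247 / 1000 - (247 / 1000 - 187 / 1000) * t) t"
      using t by simp
  qed (use n5 n6 M in simp_all)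
  have c6: ?thesis if "p \<le> 187 / 1000"
  proof -
    \<comment> \<open>Here the quadratic \<open>s y\<^sup>2 - y + (2 - B)\<close> has no real root, so no bound on the logarithm is needed.\<close>
    define s B where "s = (2 - p)\<^sup>2 / 64"
      and "B = (1 - p)\<^sup>2 - 6193 / 1000 * (1 - p) + 4 / 3 * (1 - p\<^sup>2) + 1 / 50"
    define y where "y = 2 - log growth p"
    \<comment> \<open>The discriminant is not positive: 16 times the difference, in Bernstein form
      on [0, 1/5].\<close>
    have "1 \<le> 4 * s * (2 - B)"
    proof -
      have "0 \<le> 1 / 5 - p" using that by simp
      then have "0 \<le> 27595 / 6 * (1 / 5 - p) ^ 4 + 40141 / 3 * (p * (1 / 5 - p) ^ 3)
          + 105157 / 8 * (p\<^sup>2 * (1 / 5 - p)\<^sup>2) + 903457 / 200 * (p ^ 3 * (1 / 5 - p)) + 3854 / 25 * p ^ 4"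
        using p by simp
      also have "\<dots> = 64 * s * (2 - B) - 16"
        unfolding s_def B_def by (simp add: field_simps eval_nat_numeral)
      finally show ?thesis by simp
    qed
    have "0 < s" using p by (simp add: s_def)
    have "0 \<le> s * y\<^sup>2 - y + (2 - B)"
    proof -
      have "0 \<le> (2 * s * y - 1)\<^sup>2" by simp
      also have "\<dots> \<le> (2 * s * y - 1)\<^sup>2 + (4 * s * (2 - B) - 1)" using \<open>1 \<le> 4 * s * (2 - B)\<close> by simp
      also have "\<dots> = 4 * s * (s * y\<^sup>2 - y + (2 - B))" by (simp add: power2_eq_square algebra_simps)
      finally show ?thesis using \<open>0 < s\<close> by (simp add: zero_le_mult_iff)
    qed
    moreover have "s * y\<^sup>2 \<le> s * M\<^sup>2"
    proof -
      have "log growth p \<le> 0" using p growth_bounds by simp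
      then show ?thesis
        using M \<open>0 < s\<close> by (intro mult_left_mono power_mono) (auto simp: y_def)
    qed
    moreover have "(shortfall p)\<^sup>2 + pot p = y - 2 + B"
      using that p by (simp add: pot_def shortfall_def y_def B_def)
    ultimately have "(shortfall p)\<^sup>2 + pot p \<le> s * M\<^sup>2" by linarith
    then show ?thesis by (simp add: s_def mult_ac)
  qed
  have "p \<le> 187 / 1000 \<or> 187 / 1000 \<le> p \<and> p \<le> 247 / 1000 \<or> 247 / 1000 \<le> p \<and> p \<le> 16 / 49 \<or> 16 / 49 \<le> p \<and> p \<le> 54 / 125 \<or> 54 / 125 \<le> p \<and> p \<le> 4 / 7 \<or> 4 / 7 \<le> p \<and> p \<le> 189 / 250
      \<or> 189 / 250 \<le> p \<and> p \<le> 1"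
    using p(2) by auto
  then show ?thesis
    by (elim disjE conjE) (rule c6 c5 c4 c3 c2 c1 c0, assumption+)+
qed

section \<open>Summing the squared shortfalls\<close>

text \<open>In the second alternative of \<open>step\<close> the stepsize grows, and then by at least the factor \<open>growth\<close>
  from the next step on; \<open>pot\<close> of the largest admissible next stepsize is the invariant.\<close>

lemma sum_shortfall_sq_le:
  fixes p th A :: "nat \<Rightarrow> real"
  assumes pos: "\<And>k. 1 \<le> k \<Longrightarrow> 0 < p k" "\<And>k. 1 \<le> k \<Longrightarrow> 0 < th k"
    and step: "\<And>k. 1 \<le> k \<Longrightarrow> 2 - p k \<le> 8 * A k \<and> 2 - log growth (p k) \<le> M
        \<or> 2 \<le> k \<and> p k = sqrt (1 + 3 / 4 * th (k - 1)) * p (k - 1) \<and> 1 \<le> th k"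
    and n: "1 \<le> n"
  shows "(\<Sum>k=1..n. (shortfall (p k))\<^sup>2) + pot (sqrt (1 + 3 / 4 * th n) * p n)
      \<le> M\<^sup>2 * (\<Sum>k=1..n. (A k)\<^sup>2)"
proof -
  have entry: "(shortfall (p k))\<^sup>2 + pot (sqrt (1 + 3 / 4 * th k) * p k) \<le> M\<^sup>2 * (A k)\<^sup>2"
    if k: "1 \<le> k" and ent: "2 - p k \<le> 8 * A k" "2 - log growth (p k) \<le> M" for k
  proof -
    have "1 * p k \<le> sqrt (1 + 3 / 4 * th k) * p k"
      using pos[OF k] by (intro mult_right_mono) auto
    then have "pot (sqrt (1 + 3 / 4 * th k) * p k) \<le> pot (p k)"
      using pos[OF k] by (intro pot_antimono) auto
    moreover have "(shortfall (p k))\<^sup>2 + pot (p k) \<le> M\<^sup>2 * (A k)\<^sup>2"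
    proof (cases "p k \<le> 1")
      case True
      have "(2 - p k)\<^sup>2 \<le> (8 * A k)\<^sup>2" using ent True by (intro power_mono) auto
      then have "M\<^sup>2 * (2 - p k)\<^sup>2 / 64 \<le> M\<^sup>2 * (8 * A k)\<^sup>2 / 64"
        by (intro divide_right_mono mult_left_mono) auto
      then show ?thesis
        using entry_cost[OF pos(1)[OF k] True ent(2)] by (simp add: power_mult_distrib)
    qed (simp add: shortfall_def pot_def)
    ultimately show ?thesis by linarith
  qed
  show ?thesis
    using n
  proof (induction n rule: nat_induct_at_least)
    case base
    then show ?case using entry[of 1] step[of 1] by auto
  next
    case (Suc n)
    let ?y = "\<lambda>k. sqrt (1 + 3 / 4 * th k) * p k"
    have y: "0 < ?y n" using pos[of n] Suc.hyps
      by (intro mult_pos_pos) (auto simp: add_pos_pos)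
    have "(shortfall (p (Suc n)))\<^sup>2 + pot (?y (Suc n)) \<le> pot (?y n) + M\<^sup>2 * (A (Suc n))\<^sup>2"
    proof (cases "2 - p (Suc n) \<le> 8 * A (Suc n) \<and> 2 - log growth (p (Suc n)) \<le> M")
      case True
      \<comment> \<open>A new entry pays from its own budget; potential left over from the previous
        run is discarded.\<close>
      then show ?thesis using entry[of "Suc n"] pot_nonneg[OF y] by auto
    next
      case False
      then have g: "p (Suc n) = ?y n" "1 \<le> th (Suc n)" using step[of "Suc n"] by auto
      \<comment> \<open>The bound \<open>1 <= th (Suc n)\<close> makes the next admissible factor at
        least \<open>growth\<close>.\<close>
      have "growth * ?y n \<le> sqrt (1 + 3 / 4 * th (Suc n)) * ?y n"
        using y g(2) by (intro mult_right_mono real_sqrt_le_mono) auto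
      then have "pot (?y (Suc n)) \<le> pot (growth * ?y n)"
        unfolding g(1) using mult_pos_pos[OF _ y, of growth] growth_bounds
        by (intro pot_antimono) linarith+
      then have "(shortfall (p (Suc n)))\<^sup>2 + pot (?y (Suc n)) \<le> pot (?y n)"
        using pot_step[OF y] unfolding g(1) by linarith
      moreover have "0 \<le> M\<^sup>2 * (A (Suc n))\<^sup>2" by simp
      ultimately show ?thesis by linarith
    qed
    then show ?case using Suc.IH by (simp add: algebra_simps)
  qed
qed

section \<open>Contraction of the Lyapunov function\<close>

lemma alpha_star_bounds: "982 / 1000 < alpha_star" "alpha_star < 983 / 1000"
proof -
  have "57272 / 1000 < sqrt 3281" by (rule real_less_rsqrt) (simp add: power2_eq_square)
  moreover have "sqrt 3281 < 57288 / 1000" by (rule real_less_lsqrt) (simp_all add: power2_eq_square)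
  ultimately show "982 / 1000 < alpha_star" "alpha_star < 983 / 1000"
    by (simp_all add: alpha_star_def)
qed

text \<open>\<open>alpha_star\<close> is the smaller root of this quadratic, which is the
  coefficient of \<open>k\<close> in the expansion in \<open>alpha_star_balance\<close>.\<close>

lemma alpha_star_root: "8 * (1 - alpha_star) - alpha_star / 8 - (1 - alpha_star) * alpha_star = 0"
proof -
  have "sqrt 3281 * sqrt 3281 = 3281" by simp
  then show ?thesis by (simp add: alpha_star_def field_simps)
qed

text \<open>At the largest \<open>c\<close> the product is a concave quadratic in \<open>k\<close>
  with value 1 at 0 and at 1. Used with \<open>k = \<mu> / L0\<close>: the weight of the squared
  move in \<open>Psi\<close>, even after contraction, covers the 1/4 of the descent
  inequality.\<close>

lemma alpha_star_balance:
  assumes "0 \<le> k" "k \<le> 1" "c \<le> alpha_star * k / 8"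
  shows "1 \<le> (1 - c) * (1 + (1 - alpha_star) * (8 * k))"
proof -
  have "0 \<le> k * (1 - k) * ((1 - alpha_star) * alpha_star)"
    using assms alpha_star_bounds by simp
  moreover have "(1 - alpha_star * k / 8) * (1 + (1 - alpha_star) * (8 * k))
      = 1 + k * (8 * (1 - alpha_star) - alpha_star / 8 - (1 - alpha_star) * alpha_star)
        + k * (1 - k) * ((1 - alpha_star) * alpha_star)"
    by (simp add: field_simps)
  ultimately have "1 \<le> (1 - alpha_star * k / 8) * (1 + (1 - alpha_star) * (8 * k))"
    unfolding alpha_star_root by simp
  also have "\<dots> \<le> (1 - c) * (1 + (1 - alpha_star) * (8 * k))"
    using assms alpha_star_bounds by (intro mult_right_mono) auto
  finally show ?thesis .
qed

text \<open>The difference of the sides is affine in \<open>r\<close> with slope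
  \<open>3/4 + c/4 - e'/4 >= 0\<close>, so \<open>r = e\<close> is the worst case. There the gap
  between \<open>alpha_star\<close> and 1 and the square of \<open>e\<close> absorb the product
  \<open>e * e'\<close>.\<close>

lemma contraction_dist_coeff:
  assumes "0 \<le> e" "e \<le> 1 / 8" "0 \<le> e'" "e' \<le> 1 / 8" "e \<le> r"
  defines "c \<equiv> alpha_star * (3 / 4 * e + 1 / 4 * e')"
  shows "(1 - e' / 4) * (1 - r) \<le> (1 - c) * (1 - r / 4)"
proof -
  define A where "A = alpha_star"
  have A: "982 / 1000 < A" "A < 983 / 1000" using alpha_star_bounds by (auto simp: A_def)
  have c: "0 \<le> c" using assms A by (simp add: c_def A_def)
  have "0 \<le> (r - e) * (3 / 4 + c / 4 - e' / 4)"
    using assms c by (intro mult_nonneg_nonneg) auto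
  moreover have "(1 - c) * (1 - e / 4) \<ge> (1 - e' / 4) * (1 - e)"
  proof -
    have "(1 - c) * (1 - e / 4) - (1 - e' / 4) * (1 - e)
      = (1 - A) * (3 / 4 * e + e' / 4) + 3 * A / 16 * e\<^sup>2 - (1 / 4 - A / 16) * (e * e')"
      by (simp add: c_def A_def field_simps power2_eq_square)
    moreover have "(1 - A) * (3 / 4 * e + e' / 4) \<ge> 17 / 1000 * (3 / 4 * e + e' / 4)"
      using A assms by (intro mult_right_mono) auto
    moreover have "3 * A / 16 * e\<^sup>2 \<ge> 184 / 1000 * e\<^sup>2"
      using A by (intro mult_right_mono) auto
    moreover have "(1 / 4 - A / 16) * (e * e') \<le> 1887 / 10000 * (e * e')"
      using A assms by (intro mult_right_mono) auto
    moreover have "0 \<le> 17 / 1000 * (3 / 4 * e + e' / 4) + 184 / 1000 * e\<^sup>2 - 1887 / 10000 * (e * e')"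
    proof -
      \<comment> \<open>The expression is affine in \<open>e'\<close>: interpolate between
        \<open>e' = 0\<close> and \<open>e' = 1/8\<close>, completing a square at the
        latter.\<close>
      have "0 \<le> (1 - 8 * e') * (51 / 4000 * e + 184 / 1000 * e\<^sup>2)
          + 8 * e' * (184 / 1000 * (e - 3 / 100)\<^sup>2) + 162 / 100000 * (e * e') + 29252 / 10000000 * e'"
        using assms by simp
      also have "\<dots> = 17 / 1000 * (3 / 4 * e + e' / 4) + 184 / 1000 * e\<^sup>2 - 1887 / 10000 * (e * e')"
        by (simp add: field_simps power2_eq_square)
      finally show ?thesis .
    qed
    ultimately show ?thesis by linarith
  qed
  ultimately show ?thesis by (simp add: field_simps)
qed

text \<open>\<open>X\<close>, \<open>X'\<close> are squared distances, \<open>a\<close>,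
  \<open>b\<close> consecutive move lengths, \<open>F0\<close>, \<open>F1\<close> function gaps. The
  coefficients of \<open>X\<close> and \<open>a^2\<close> are compared directly. The excess of
  \<open>F0\<close> is traded for \<open>F1\<close> and \<open>th^2 * a^2\<close>, then paid by the
  strong convexity term in \<open>a^2\<close>, the spare part of \<open>F1\<close> and a reserve of
  \<open>b^2\<close>.\<close>

lemma contraction_step:
  fixes X X' a b l l' th th' F0 F1 \<mu> L0 :: real
  assumes pos: "0 \<le> X" "0 \<le> X'" "0 \<le> a" "0 < l" "0 < l'" "0 < th" "0 \<le> F0" "0 \<le> F1"
    and mu: "0 < \<mu>" "\<mu> \<le> L0"
    and descent: "X' + 3 / 4 * b\<^sup>2 + 2 * l * (1 + th) * F1
        \<le> (1 - l * \<mu>) * X + (1 / 4 - l * th * \<mu>) * a\<^sup>2 + 2 * l * th * F0"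
    and grad_step: "th * a \<le> b + a / 4"
    and f_step: "l * th * F0 \<le> l * th * F1 + th\<^sup>2 * a\<^sup>2"
    and pl: "2 * \<mu> * l\<^sup>2 * F1 \<le> b\<^sup>2"
    and th': "th'\<^sup>2 \<le> 1 + 3 / 4 * th" "l' = th' * l"
  defines "e \<equiv> min (l * \<mu>) (\<mu> / (8 * L0))" and "e' \<equiv> min (l' * \<mu>) (\<mu> / (8 * L0))"
    and "w \<equiv> 1 / 4 * (1 + (1 - alpha_star) * (8 * \<mu> / L0))"
  shows "(1 - l' * \<mu> / 4) * X' + w * b\<^sup>2 + 2 * l' * th' * F1
      \<le> (1 - alpha_star * (3 / 4 * e + 1 / 4 * e'))
          * ((1 - l * \<mu> / 4) * X + w * a\<^sup>2 + 2 * l * th * F0)"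
proof -
  define A where "A = alpha_star"
  have A: "982 / 1000 < A" "A < 983 / 1000" using alpha_star_bounds by (auto simp: A_def)
  define k where "k = \<mu> / L0"
  have k: "0 < k" "k \<le> 1" using mu by (auto simp: k_def)
  have kL: "\<mu> / (8 * L0) = k / 8" by (simp add: k_def)
  define c where "c = alpha_star * (3 / 4 * e + 1 / 4 * e')"
  have e: "0 < e" "e \<le> k / 8" "e \<le> 1 / 8" "e \<le> l * \<mu>"
    and e': "0 < e'" "e' \<le> k / 8" "e' \<le> 1 / 8" "e' \<le> l' * \<mu>"
    using pos mu k by (auto simp: e_def e'_def kL)
  have c_eq: "c = A * (3 / 4 * e + 1 / 4 * e')" by (simp add: c_def A_def)
  have ck: "c \<le> alpha_star * k / 8"
  proof -
    have "A * (3 / 4 * e + 1 / 4 * e') \<le> A * (k / 8)"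
      using e e' A by (intro mult_left_mono) auto
    then show ?thesis by (simp add: c_def A_def)
  qed
  have w_eq: "w = 1 / 4 * (1 + (1 - alpha_star) * (8 * k))" by (simp add: w_def k_def)
  have w_le: "w \<le> 1 / 4 * (1 + 18 / 1000 * 8)"
  proof -
    have "(1 - A) * (8 * k) \<le> 18 / 1000 * (8 * 1)" using A k by (intro mult_mono) auto
    then show ?thesis by (simp add: w_eq A_def)
  qed
  have cX: "(1 - e' / 4) * (1 - l * \<mu>) * X \<le> (1 - c) * (1 - l * \<mu> / 4) * X"
    using contraction_dist_coeff[of e e' "l * \<mu>"] e e' pos(1)
    unfolding c_def by (intro mult_right_mono) auto
  have ca: "(1 - e' / 4) * (1 / 4) * a\<^sup>2 \<le> (1 - c) * w * a\<^sup>2"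
  proof (rule mult_right_mono)
    have "1 / 4 \<le> (1 - c) * w"
      using alpha_star_balance[of k c] k ck unfolding w_eq by simp
    moreover have "(1 - e' / 4) * (1 / 4) \<le> 1 / 4" using e' by simp
    ultimately show "(1 - e' / 4) * (1 / 4) \<le> (1 - c) * w" by linarith
  qed simp
  \<comment> \<open>The stepsize rule needs only 3/4 of the \<open>th\<close> term that descent
    provides; \<open>th / 4\<close> is spare.\<close>
  have F': "2 * l' * th' * F1 \<le> 2 * l * (1 + 3 / 4 * th) * F1"
  proof -
    have "l * th'\<^sup>2 \<le> l * (1 + 3 / 4 * th)" using th' pos by (intro mult_left_mono) auto
    then have "l * th'\<^sup>2 * F1 \<le> l * (1 + 3 / 4 * th) * F1" using pos by (intro mult_right_mono) auto
    then show ?thesis by (simp add: th'(2) power2_eq_square algebra_simps)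
  qed
  have l'X: "(1 - l' * \<mu> / 4) * X' \<le> (1 - e' / 4) * X'"
    using e' pos by (intro mult_right_mono) auto
  \<comment> \<open>For \<open>th\<close> up to 65/100 the strong convexity term pays, 31/32 being
    the least value of \<open>1 - e' / 4\<close>. For larger \<open>th\<close>,
    \<open>grad_step\<close> forces \<open>b >= (th - 1/4) * a\<close>.\<close>
  have quad: "3 / 2 * A * (e * (th\<^sup>2 * a\<^sup>2)) \<le> 31 / 32 * (e * (th * a\<^sup>2)) \<or>
     1 / 4 \<le> th \<and> 3 / 2 * A * (e * (th\<^sup>2 * a\<^sup>2)) \<le> 31 / 32 * (e * (th * a\<^sup>2)) + 44 / 100 * b\<^sup>2"
  proof (cases "th \<le> 65 / 100")
    case True
    have "3 / 2 * A * th \<le> 3 / 2 * (983 / 1000) * (65 / 100)"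
      using True pos A by (intro mult_mono) auto
    then have "3 / 2 * A * th * (e * (th * a\<^sup>2)) \<le> 31 / 32 * (e * (th * a\<^sup>2))"
      using e pos by (intro mult_right_mono) auto
    then show ?thesis by (simp add: power2_eq_square mult_ac)
  next
    case False
    have "(th - 1 / 4) * a \<le> b" using grad_step by (simp add: algebra_simps)
    then have "((th - 1 / 4) * a)\<^sup>2 \<le> b\<^sup>2"
      using False pos by (intro power_mono) auto
    then have b: "44 / 100 * ((th - 1 / 4)\<^sup>2 * a\<^sup>2) \<le> 44 / 100 * b\<^sup>2"
      by (simp only: power_mult_distrib)
    have "3 / 2 * A * (e * th\<^sup>2) - 31 / 32 * (e * th) \<le> 44 / 100 * (th - 1 / 4)\<^sup>2"
    proof (cases "3 / 2 * A * th \<le> 31 / 32")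
      case True
      then have "3 / 2 * A * th * (e * th) \<le> 31 / 32 * (e * th)"
        using e pos by (intro mult_right_mono) auto
      then have "3 / 2 * A * (e * th\<^sup>2) - 31 / 32 * (e * th) \<le> 0"
        by (simp add: power2_eq_square mult_ac)
      also have "0 \<le> 44 / 100 * (th - 1 / 4)\<^sup>2" by simp
      finally show ?thesis .
    next
      case False
      have "e * (th * (3 / 2 * A * th - 31 / 32)) \<le> 1 / 8 * (th * (3 / 2 * A * th - 31 / 32))"
        using False e pos by (intro mult_right_mono mult_nonneg_nonneg) auto
      also have "\<dots> = 3 / 16 * A * th\<^sup>2 - 31 / 256 * th" by (simp add: power2_eq_square algebra_simps)
      also have "\<dots> \<le> 3 / 16 * (983 / 1000) * th\<^sup>2 - 31 / 256 * th"
        using A by (intro diff_right_mono mult_right_mono) auto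
      also have "\<dots> \<le> 44 / 100 * (th - 1 / 4)\<^sup>2"
      proof -
        have "0 \<le> (th - 2 / 10)\<^sup>2" by simp
        then show ?thesis using pos(6) by (simp add: power2_eq_square algebra_simps)
      qed
      finally show ?thesis by (simp add: power2_eq_square algebra_simps)
    qed
    then have "(3 / 2 * A * (e * th\<^sup>2) - 31 / 32 * (e * th)) * a\<^sup>2 \<le> 44 / 100 * (th - 1 / 4)\<^sup>2 * a\<^sup>2"
      by (rule mult_right_mono) simp
    then show ?thesis using b False by (simp add: algebra_simps)
  qed
  \<comment> \<open>The coefficient of \<open>F1\<close> can be positive only for
    \<open>th < 1/4\<close>. Then \<open>l'\<close> is at most 11/10 of \<open>l\<close>, and
    \<open>pl\<close> converts the term into \<open>b^2\<close>.\<close>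
  have lin: "2 * l * (3 / 4 * A * e * th + e' / 4 * (1 + th) - th / 4) * F1
      \<le> (if 1 / 4 \<le> th then 0 else 44 / 100 * b\<^sup>2)"
  proof -
    have "3 / 4 * A * e \<le> 3 / 4 * (983 / 1000) * (1 / 8)" using A e by (intro mult_mono) auto
    then have co: "3 / 4 * A * e + e' / 4 - 1 / 4 \<le> - 1 / 8" using e' by simp
    then have "(3 / 4 * A * e + e' / 4 - 1 / 4) * th \<le> - 1 / 8 * th"
      using pos by (intro mult_right_mono) auto
    then have co: "3 / 4 * A * e * th + e' / 4 * (1 + th) - th / 4 \<le> e' / 4 - th / 8"
      by (simp add: algebra_simps add_divide_distrib)
    show ?thesis
    proof (cases "1 / 4 \<le> th")
      case True
      then have "3 / 4 * A * e * th + e' / 4 * (1 + th) - th / 4 \<le> 0"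
        using co e' by simp
      then show ?thesis using True pos by (simp add: mult_nonneg_nonpos mult_nonpos_nonneg)
    next
      case False
      have "th'\<^sup>2 \<le> (11 / 10)\<^sup>2" using th' False by (simp add: power2_eq_square)
      then have "th' \<le> 11 / 10" by (rule power2_le_imp_le) simp
      then have "l' * \<mu> \<le> 11 / 10 * l * \<mu>" using th' pos mu by simp
      then have "e' / 4 - th / 8 \<le> 11 / 40 * (l * \<mu>)" using e' pos by simp
      then have "2 * l * (3 / 4 * A * e * th + e' / 4 * (1 + th) - th / 4) * F1
          \<le> 2 * l * (11 / 40 * (l * \<mu>)) * F1"
        using co pos by (intro mult_right_mono mult_left_mono) auto
      also have "\<dots> = 11 / 40 * (2 * \<mu> * l\<^sup>2 * F1)" by (simp add: power2_eq_square)
      also have "\<dots> \<le> 44 / 100 * b\<^sup>2"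
        using pl zero_le_power2[of b] by linarith
      finally show ?thesis using False by simp
    qed
  qed
  \<comment> \<open>The reserve of \<open>b^2\<close> is spent only once: \<open>quad\<close> uses
    it only for \<open>th >= 1/4\<close>, \<open>lin\<close> only for
    \<open>th < 1/4\<close>.\<close>
  have both: "3 / 2 * A * (e * (th\<^sup>2 * a\<^sup>2)) + 2 * l * (3 / 4 * A * e * th + e' / 4 * (1 + th) - th / 4) * F1
      \<le> 31 / 32 * (e * (th * a\<^sup>2)) + 44 / 100 * b\<^sup>2"
  proof (cases "1 / 4 \<le> th")
    case True
    show ?thesis
      using quad lin[unfolded if_P[OF True]] zero_le_power2[of b] by linarith
  next
    case False
    show ?thesis
      using quad lin[unfolded if_not_P[OF False]] False by linarith
  qed
  \<comment> \<open>The reserve: 3/4 scaled by at least 31/32, less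
    \<open>w <= 286/1000\<close>.\<close>
  have bb: "44 / 100 * b\<^sup>2 \<le> ((1 - e' / 4) * (3 / 4) - w) * b\<^sup>2"
  proof (rule mult_right_mono)
    have eq: "(1 - e' / 4) * (3 / 4) = 3 / 4 - 3 / 16 * e'" by (simp add: field_simps)
    have "44 / 100 \<le> 3 / 4 - 3 / 16 * e' - w" using w_le e'(3) by simp
    then show "44 / 100 \<le> (1 - e' / 4) * (3 / 4) - w" unfolding eq .
  qed simp
  have ea: "31 / 32 * (e * (th * a\<^sup>2)) \<le> (1 - e' / 4) * (l * th * \<mu> * a\<^sup>2)"
  proof -
    have "31 / 32 * (e * (th * a\<^sup>2)) \<le> (1 - e' / 4) * ((l * \<mu>) * (th * a\<^sup>2))"
      using e e' pos by (intro mult_mono mult_right_mono) auto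
    then show ?thesis by (simp add: mult_ac)
  qed
  have F0: "(c - e' / 4) * (2 * l * th * F0) \<le> 3 / 4 * A * e * (2 * l * th * F1) + 3 / 2 * A * (e * (th\<^sup>2 * a\<^sup>2))"
  proof -
    have "c - e' / 4 \<le> 3 / 4 * A * e" using A e' unfolding c_eq
      by (simp add: algebra_simps)
    then have "(c - e' / 4) * (2 * l * th * F0) \<le> 3 / 4 * A * e * (2 * l * th * F0)"
      using pos by (intro mult_right_mono) auto
    also have "\<dots> \<le> 3 / 4 * A * e * (2 * (l * th * F1 + th\<^sup>2 * a\<^sup>2))"
      using f_step A e by (intro mult_left_mono) auto
    finally show ?thesis by (simp add: algebra_simps)
  qed
  \<comment> \<open>A quarter of the contraction is spent before the descent step (factor \<open>1 - e' / 4\<close>), the rest after it.\<close>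
  have scaled: "(1 - e' / 4) * (X' + 3 / 4 * b\<^sup>2 + 2 * l * (1 + th) * F1)
      \<le> (1 - e' / 4) * ((1 - l * \<mu>) * X + (1 / 4 - l * th * \<mu>) * a\<^sup>2 + 2 * l * th * F0)"
    using descent e' by (intro mult_left_mono) auto
  have expand: "r * (X' + 3 / 4 * b\<^sup>2 + 2 * l * (1 + th) * F1)
      = r * X' + r * (3 / 4) * b\<^sup>2 + r * (2 * l * (1 + th) * F1)"
    "r * ((1 - l * \<mu>) * X + (1 / 4 - l * th * \<mu>) * a\<^sup>2 + 2 * l * th * F0)
      = r * (1 - l * \<mu>) * X + r * (1 / 4) * a\<^sup>2 - r * (l * th * \<mu> * a\<^sup>2) + r * (2 * l * th * F0)" for r
    by (simp_all add: algebra_simps)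
  have shift: "u \<le> z - v - w" if "u + v + w \<le> z" for u v w z :: real
    using that by simp
  have main: "(1 - e' / 4) * X' \<le> (1 - e' / 4) * (1 - l * \<mu>) * X + (1 - e' / 4) * (1 / 4) * a\<^sup>2
      - (1 - e' / 4) * (l * th * \<mu> * a\<^sup>2) + (1 - e' / 4) * (2 * l * th * F0)
      - (1 - e' / 4) * (3 / 4) * b\<^sup>2 - (1 - e' / 4) * (2 * l * (1 + th) * F1)"
    using scaled unfolding expand by (rule shift)
  have f1_id: "2 * l * (1 + 3 / 4 * th) * F1 - (1 - e' / 4) * (2 * l * (1 + th) * F1)
      + 3 / 4 * A * e * (2 * l * th * F1)
      = 2 * l * (3 / 4 * A * e * th + e' / 4 * (1 + th) - th / 4) * F1"
    by (simp add: field_simps)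
  have f0_id: "(1 - e' / 4) * (2 * l * th * F0)
      = (1 - c) * (2 * l * th * F0) + (c - e' / 4) * (2 * l * th * F0)"
    by (simp add: algebra_simps)
  have b_id: "((1 - e' / 4) * (3 / 4) - w) * b\<^sup>2 = (1 - e' / 4) * (3 / 4) * b\<^sup>2 - w * b\<^sup>2"
    by (rule left_diff_distrib)
  have "(1 - l' * \<mu> / 4) * X' + w * b\<^sup>2 + 2 * l' * th' * F1
      \<le> (1 - c) * (1 - l * \<mu> / 4) * X + (1 - c) * w * a\<^sup>2 + (1 - c) * (2 * l * th * F0)"
    using cX ca F' l'X both bb ea F0 main f1_id f0_id b_id by argo
  also have "\<dots> = (1 - c) * ((1 - l * \<mu> / 4) * X + w * a\<^sup>2 + 2 * l * th * F0)"
    by (simp only: distrib_left mult.assoc)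
  finally have "(1 - l' * \<mu> / 4) * X' + w * b\<^sup>2 + 2 * l' * th' * F1
      \<le> (1 - c) * ((1 - l * \<mu> / 4) * X + w * a\<^sup>2 + 2 * l * th * F0)" .
  then show ?thesis unfolding c_def .
qed

section \<open>From a product of factors to a power of their mean\<close>

lemma prod_le_mean_power:
  fixes h :: "'b \<Rightarrow> real"
  assumes "finite S" "S \<noteq> {}" "\<And>i. i \<in> S \<Longrightarrow> 0 \<le> h i"
  shows "(\<Prod>i\<in>S. h i) \<le> ((\<Sum>i\<in>S. h i) / card S) ^ card S"
proof -
  have n: "0 < card S" using assms by (simp add: card_gt_0_iff)
  have nn: "0 \<le> (\<Prod>i\<in>S. h i)" using assms(3) by (rule prod_nonneg)
  have "(\<Prod>i\<in>S. h i) = ((\<Prod>i\<in>S. h i) powr (1 / card S)) ^ card S"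
  proof (cases "(\<Prod>i\<in>S. h i) = 0")
    case True
    then show ?thesis using n by simp
  next
    case False
    then show ?thesis using nn n by (simp add: powr_powr flip: powr_realpow)
  qed
  also have "\<dots> \<le> (\<Sum>i\<in>S. h i / card S) ^ card S"
    using arith_geom_mean[OF assms] by (intro power_mono) auto
  finally show ?thesis by (simp add: sum_divide_distrib)
qed

section \<open>AdGD runs\<close>

locale adgd =
  fixes f :: "'a::euclidean_space \<Rightarrow> real" and \<mu> L0 L1 :: real
    and xs :: 'a and x :: "nat \<Rightarrow> 'a" and lam :: "nat \<Rightarrow> real"
  assumes differentiable: "\<And>z. f differentiable (at z)"
    and mu_pos: "0 < \<mu>" and strongly_convex: "strongly_convex \<mu> f"
    and L0_pos: "0 < L0" and L1_nonneg: "0 \<le> L1" and asym_smooth: "asym_smooth L0 L1 f"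
    and minimizer: "\<And>z. f xs \<le> f z"
    and run: "adgd_run f x lam"
begin

abbreviation g :: "nat \<Rightarrow> 'a" where "g k \<equiv> grad f (x k)"
abbreviation F :: "nat \<Rightarrow> real" where "F k \<equiv> f (x k) - f xs"
abbreviation move :: "nat \<Rightarrow> real" where "move k \<equiv> norm (x k - x (k - 1))"
abbreviation ratio :: "nat \<Rightarrow> real" where "ratio \<equiv> step_ratio lam"

section \<open>Consequences of the hypotheses and of the stepsize rule\<close>

lemma F_nonneg: "0 \<le> F k"
  using minimizer by simp

lemma grad_minimizer: "grad f xs = 0"
proof -
  have "(f has_derivative (\<lambda>h. h \<bullet> grad f xs)) (at xs)"
    using gderiv_grad[OF differentiable] by (simp add: gderiv_def)
  then have "(\<lambda>h. h \<bullet> grad f xs) = (\<lambda>h. 0)"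
    using minimizer by (intro differential_zero_maxmin[of xs UNIV f]) auto
  then have "grad f xs \<bullet> grad f xs = 0" by metis
  then show ?thesis by simp
qed

lemma strong_convexity: "f u + grad f u \<bullet> (v - u) + \<mu> / 2 * (norm (u - v))\<^sup>2 \<le> f v"
  using strongly_convex unfolding strongly_convex_def by blast

lemma next_iterate: "x (Suc k) = x k - lam k *\<^sub>R g k"
  using run by (simp add: adgd_run_def)

lemma grad_neq: "1 \<le> k \<Longrightarrow> g k \<noteq> g (k - 1)"
  using run by (simp add: adgd_run_def)

lemma move_pos: "1 \<le> k \<Longrightarrow> 0 < move k"
  using grad_neq[of k] by fastforce

lemma local_step_pos: "1 \<le> k \<Longrightarrow> 0 < local_step f x k"
  using grad_neq[of k] move_pos[of k] by (simp add: local_step_def)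

lemma lam_cases:
  assumes "1 \<le> k"
  obtains "lam k = local_step f x k"
  | "2 \<le> k" "lam k = sqrt (1 + 3 * ratio (k - 1) / 4) * lam (k - 1)" "lam k \<le> local_step f x k"
  using assms run unfolding adgd_run_def min_def
  by (metis One_nat_def Suc_1 le_antisym not_less_eq_eq)

lemma lam_pos: "0 < lam k"
proof (induction k rule: less_induct)
  case (less k)
  show ?case
  proof (cases "k = 0")
    case True
    then show ?thesis using run by (simp add: adgd_run_def)
  next
    case False
    then have "1 \<le> k" by simp
    then show ?thesis
    proof (cases rule: lam_cases)
      case 1
      then show ?thesis using local_step_pos[OF \<open>1 \<le> k\<close>] by simp
    next
      case 2
      have "0 < lam (k - 1)" "0 < lam (k - 1 - 1)" using less 2(1) by auto
      then have "0 < ratio (k - 1)" by (simp add: step_ratio_def)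
      then show ?thesis using 2(2) \<open>0 < lam (k - 1)\<close> by (simp add: add_pos_pos)
    qed
  qed
qed

lemma ratio_pos: "0 < ratio k"
  by (simp add: step_ratio_def lam_pos)

lemma ratio_lam: "ratio k * lam (k - 1) = lam k"
  using lam_pos[of "k - 1"] by (simp add: step_ratio_def)

lemma lam_le_local_step: "1 \<le> k \<Longrightarrow> lam k \<le> local_step f x k"
  by (erule lam_cases) auto

lemma lam_grad_diff: "1 \<le> k \<Longrightarrow> lam k * norm (g k - g (k - 1)) \<le> move k / 4"
  using lam_le_local_step[of k] grad_neq[of k] by (simp add: local_step_def field_simps)

lemma move_eq: "move (Suc k) = lam k * norm (g k)"
  using lam_pos[of k] by (simp add: next_iterate)

lemma move_eq': "1 \<le> k \<Longrightarrow> move k = lam (k - 1) * norm (g (k - 1))"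
  using move_eq[of "k - 1"] by simp

lemma ratio_move: "1 \<le> k \<Longrightarrow> ratio k * move k = lam k * norm (g (k - 1))"
  using move_eq'[of k] ratio_lam[of k] by (metis mult.assoc)

lemma ratio_sq_le:
  assumes "2 \<le> k"
  shows "(ratio k)\<^sup>2 \<le> 1 + 3 / 4 * ratio (k - 1)"
proof -
  have "lam k \<le> sqrt (1 + 3 * ratio (k - 1) / 4) * lam (k - 1)"
    using run assms by (simp add: adgd_run_def)
  then have "ratio k \<le> sqrt (1 + 3 * ratio (k - 1) / 4)"
    using lam_pos[of "k - 1"] by (simp add: step_ratio_def pos_divide_le_eq)
  then have "(ratio k)\<^sup>2 \<le> (sqrt (1 + 3 * ratio (k - 1) / 4))\<^sup>2"
    using ratio_pos[of k] by (intro power_mono) auto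
  also have "\<dots> = 1 + 3 / 4 * ratio (k - 1)"
    using ratio_pos[of "k - 1"] by simp
  finally show ?thesis .
qed

text \<open>The Polyak-Lojasiewicz inequality: the gap in minimizing the quadratic lower bound at
  \<open>z\<close> is this completed square.\<close>

lemma PL_inequality: "2 * \<mu> * (f z - f xs) \<le> (norm (grad f z))\<^sup>2"
proof -
  have "0 \<le> (norm (grad f z + \<mu> *\<^sub>R (xs - z)))\<^sup>2" by simp
  also have "\<dots> = (norm (grad f z))\<^sup>2 + 2 * \<mu> * (grad f z \<bullet> (xs - z) + \<mu> / 2 * (norm (z - xs))\<^sup>2)"
    by (simp only: power2_norm_eq_inner) (simp add: inner_simps inner_commute algebra_simps)
  also have "\<dots> \<le> (norm (grad f z))\<^sup>2 + 2 * \<mu> * (f xs - f z)"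
    using strong_convexity[of z xs] mu_pos by (intro add_left_mono mult_left_mono) auto
  finally show ?thesis by (simp add: algebra_simps)
qed

lemma strong_monotonicity: "\<mu> * norm (u - v) \<le> norm (grad f u - grad f v)"
proof (cases "u = v")
  case False
  have "\<mu> * (norm (u - v))\<^sup>2 \<le> (grad f u - grad f v) \<bullet> (u - v)"
    using strong_convexity[of u v] strong_convexity[of v u]
    by (simp add: norm_minus_commute[of v u] inner_simps algebra_simps)
  also have "\<dots> \<le> norm (grad f u - grad f v) * norm (u - v)" by (rule norm_cauchy_schwarz)
  finally have "\<mu> * norm (u - v) * norm (u - v) \<le> norm (grad f u - grad f v) * norm (u - v)"
    by (simp add: power2_eq_square mult.assoc)
  then show ?thesis using False by simp
qed simp

text \<open>Asymmetric smoothness with the minimizer in the second place, where the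
  \<open>L1\<close> term vanishes.\<close>

lemma grad_le: "norm (grad f z) \<le> L0 * norm (z - xs)"
proof -
  have "norm (grad f z - grad f xs) \<le> (L0 + L1 * norm (grad f xs)) * norm (z - xs)"
    using asym_smooth unfolding asym_smooth_def by blast
  then show ?thesis by (simp add: grad_minimizer)
qed

lemma mu_le_L0: "\<mu> \<le> L0"
proof -
  \<comment> \<open>A point other than the minimizer is needed; well-definedness of the run provides
    one.\<close>
  have "x 0 \<noteq> xs \<or> x 1 \<noteq> xs" using grad_neq[of 1] by auto
  then obtain z where z: "z \<noteq> xs" by blast
  then have "\<mu> * norm (z - xs) \<le> L0 * norm (z - xs)"
    using strong_monotonicity[of z xs] grad_le[of z] by (simp only: grad_minimizer diff_0_right)
  then show ?thesis using z by simp
qed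

lemma lam_mu_le: "1 \<le> k \<Longrightarrow> lam k * \<mu> \<le> 1 / 4"
proof -
  assume k: "1 \<le> k"
  have "lam k * \<mu> * move k \<le> lam k * norm (g k - g (k - 1))"
    using strong_monotonicity[of "x k" "x (k - 1)"] lam_pos[of k] by simp
  also have "\<dots> \<le> 1 / 4 * move k" using lam_grad_diff[OF k] by simp
  finally show ?thesis using grad_neq[OF k] by (subst (asm) mult_le_cancel_right) auto
qed

text \<open>The squared step is split along \<open>g k - g (k - 1)\<close> and
  \<open>g (k - 1)\<close>. The first part is bounded by Cauchy-Schwarz and the local stepsize; the
  second is a multiple of the previous move and is bounded by strong convexity.\<close>

lemma descent:
  assumes k: "1 \<le> k"
  shows "(norm (x (Suc k) - xs))\<^sup>2 + 3 / 4 * (move (Suc k))\<^sup>2 + 2 * lam k * (1 + ratio k) * F k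
    \<le> (1 - lam k * \<mu>) * (norm (x k - xs))\<^sup>2 + (1 / 4 - lam k * ratio k * \<mu>) * (move k)\<^sup>2
      + 2 * lam k * ratio k * F (k - 1)"
proof -
  define l t where "l = lam k" and "t = ratio k"
  define X where "X = (norm (x k - xs))\<^sup>2"
  have l: "0 < l" and t: "0 < t" using lam_pos ratio_pos by (auto simp: l_def t_def)
  have X': "(norm (x (Suc k) - xs))\<^sup>2 = X - 2 * l * (g k \<bullet> (x k - xs)) + (move (Suc k))\<^sup>2"
    unfolding X_def l_def next_iterate
    by (simp only: power2_norm_eq_inner diff_Suc_1 next_iterate)
      (simp add: inner_simps inner_commute algebra_simps)
  have "F k + \<mu> / 2 * X \<le> g k \<bullet> (x k - xs)"
    using strong_convexity[of "x k" xs] by (simp add: X_def inner_simps)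
  then have a1: "2 * l * (F k + \<mu> / 2 * X) \<le> 2 * l * (g k \<bullet> (x k - xs))"
    using l by (intro mult_left_mono) auto
  have "g k \<bullet> (x (k - 1) - x k) \<le> F (k - 1) - F k - \<mu> / 2 * (move k)\<^sup>2"
    using strong_convexity[of "x k" "x (k - 1)"] by simp
  then have a2: "l * t * (g k \<bullet> (x (k - 1) - x k)) \<le> l * t * (F (k - 1) - F k - \<mu> / 2 * (move k)\<^sup>2)"
    using l t by (intro mult_left_mono) auto
  have "x (k - 1) - x k = lam (k - 1) *\<^sub>R g (k - 1)"
    using next_iterate[of "k - 1"] k by simp
  then have "l * t * (g k \<bullet> (x (k - 1) - x k)) = l\<^sup>2 * (g k \<bullet> g (k - 1))"
    using ratio_lam[of k] by (simp add: l_def t_def power2_eq_square)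
  then have sq: "(move (Suc k))\<^sup>2 = l\<^sup>2 * (g k \<bullet> (g k - g (k - 1))) + l * t * (g k \<bullet> (x (k - 1) - x k))"
    unfolding move_eq by (simp add: l_def power_mult_distrib power2_norm_eq_inner inner_simps algebra_simps)
  have "l\<^sup>2 * (g k \<bullet> (g k - g (k - 1))) \<le> l\<^sup>2 * (norm (g k) * norm (g k - g (k - 1)))"
    by (intro mult_left_mono norm_cauchy_schwarz) auto
  also have "\<dots> = move (Suc k) * (l * norm (g k - g (k - 1)))"
    unfolding move_eq by (simp add: l_def power2_eq_square)
  also have "\<dots> \<le> move (Suc k) * (move k / 4)"
    using lam_grad_diff[OF k] by (intro mult_left_mono) (auto simp: l_def)
  also have "\<dots> \<le> ((move k)\<^sup>2 + (move (Suc k))\<^sup>2) / 8"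
    using sum_squares_bound[of "move k" "move (Suc k)"] by (simp add: mult_ac)
  \<comment> \<open>Doubled, this bounds 7/4 of the squared move: 1 for the expanded distance and
    3/4 for the claim.\<close>
  finally have "(move (Suc k))\<^sup>2 \<le> ((move k)\<^sup>2 + (move (Suc k))\<^sup>2) / 8
      + l * t * (F (k - 1) - F k - \<mu> / 2 * (move k)\<^sup>2)"
    using sq a2 by linarith
  then show ?thesis
    unfolding X' unfolding X_def[symmetric] l_def[symmetric] t_def[symmetric]
    using a1 by (simp add: algebra_simps add_divide_distrib)
qed

text \<open>Truncation at stepsize \<open>1 / (8 * L0)\<close>, which keeps the contraction within
  the range of \<open>alpha_star_balance\<close>.\<close>

definition capped :: "nat \<Rightarrow> real" where
  "capped k = min (lam k * \<mu>) (\<mu> / (8 * L0))"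

lemma Psi_contraction:
  assumes k: "1 \<le> k"
  shows "Psi f \<mu> L0 xs x lam (Suc k)
    \<le> (1 - alpha_star * (3 / 4 * capped k + 1 / 4 * capped (Suc k))) * Psi f \<mu> L0 xs x lam k"
proof -
  \<comment> \<open>Convexity at the previous iterate bounds \<open>F (k - 1) - F k\<close> by
    \<open>lam (k - 1)\<close> times a squared gradient.\<close>
  have f_step: "lam k * ratio k * F (k - 1) \<le> lam k * ratio k * F k + (ratio k)\<^sup>2 * (move k)\<^sup>2"
  proof -
    have "x k - x (k - 1) = - (lam (k - 1) *\<^sub>R g (k - 1))"
      using next_iterate[of "k - 1"] k by simp
    then have "g (k - 1) \<bullet> (x k - x (k - 1)) = - (lam (k - 1) * (norm (g (k - 1)))\<^sup>2)"
      by (simp only: power2_norm_eq_inner inner_minus_right inner_scaleR_right)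
    moreover have "0 \<le> \<mu> / 2 * (norm (x (k - 1) - x k))\<^sup>2" using mu_pos by simp
    ultimately have "F (k - 1) \<le> F k + lam (k - 1) * (norm (g (k - 1)))\<^sup>2"
      using strong_convexity[of "x (k - 1)" "x k"] by linarith
    then have "lam k * ratio k * F (k - 1) \<le> lam k * ratio k * (F k + lam (k - 1) * (norm (g (k - 1)))\<^sup>2)"
      using lam_pos[of k] ratio_pos[of k] by (intro mult_left_mono) auto
    also have "lam k * ratio k * (F k + lam (k - 1) * (norm (g (k - 1)))\<^sup>2)
        = lam k * ratio k * F k + lam k * (ratio k * lam (k - 1)) * (norm (g (k - 1)))\<^sup>2"
      by (simp add: algebra_simps)
    also have "\<dots> = lam k * ratio k * F k + (ratio k * move k)\<^sup>2"
      unfolding ratio_move[OF k] ratio_lam by (simp add: power_mult_distrib power2_eq_square)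
    finally show ?thesis by (simp add: power_mult_distrib)
  qed
  have grad_step: "ratio k * move k \<le> move (Suc k) + move k / 4"
  proof -
    have "norm (g (k - 1)) \<le> norm (g k) + norm (g k - g (k - 1))"
      by (metis norm_minus_commute norm_triangle_sub)
    then have "lam k * norm (g (k - 1)) \<le> lam k * (norm (g k) + norm (g k - g (k - 1)))"
      using lam_pos[of k] by (intro mult_left_mono) auto
    then show ?thesis
      unfolding ratio_move[OF k] move_eq using lam_grad_diff[OF k] by (simp add: algebra_simps)
  qed
  have pl: "2 * \<mu> * (lam k)\<^sup>2 * F k \<le> (move (Suc k))\<^sup>2"
  proof -
    have "(lam k)\<^sup>2 * (2 * \<mu> * F k) \<le> (lam k)\<^sup>2 * (norm (g k))\<^sup>2"
      using PL_inequality[of "x k"] by (intro mult_left_mono) auto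
    then show ?thesis unfolding move_eq by (simp add: power_mult_distrib algebra_simps)
  qed
  have rs: "(ratio (Suc k))\<^sup>2 \<le> 1 + 3 / 4 * ratio k" using ratio_sq_le[of "Suc k"] k by simp
  have rl: "lam (Suc k) = ratio (Suc k) * lam k" using ratio_lam[of "Suc k"] by simp
  show ?thesis
    using contraction_step[OF _ _ _ lam_pos[of k] lam_pos[of "Suc k"] ratio_pos[of k]
        F_nonneg[of "k - 1"] F_nonneg[of k] mu_pos mu_le_L0 descent[OF k] grad_step f_step pl rs rl]
    unfolding Psi_def capped_def by simp
qed

text \<open>The weight 3/4, against the 1/4 in the descent inequality, releases half a squared move
  per step; \<open>energy 1\<close> is the square of \<open>D\<close>.\<close>

definition energy :: "nat \<Rightarrow> real" where
  "energy k = (norm (x k - xs))\<^sup>2 + 3 / 4 * (move k)\<^sup>2 + 2 * lam k * ratio k * F (k - 1)"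

lemma energy_descent:
  assumes k: "1 \<le> k"
  shows "energy (Suc k) + 1 / 2 * (move k)\<^sup>2 \<le> energy k"
proof -
  have "lam (Suc k) * ratio (Suc k) = lam k * (ratio (Suc k))\<^sup>2"
    using ratio_lam[of "Suc k"] by (simp add: power2_eq_square mult_ac)
  also have "\<dots> \<le> lam k * (1 + ratio k)"
    using ratio_sq_le[of "Suc k"] ratio_pos[of k] lam_pos[of k] k by (intro mult_left_mono) auto
  finally have "2 * (lam (Suc k) * ratio (Suc k)) * F k \<le> 2 * (lam k * (1 + ratio k)) * F k"
    using F_nonneg[of k] by (intro mult_right_mono) auto
  moreover have "0 \<le> lam k * \<mu> * (norm (x k - xs))\<^sup>2" "0 \<le> lam k * ratio k * \<mu> * (move k)\<^sup>2"
    using lam_pos[of k] ratio_pos[of k] mu_pos by simp_all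
  ultimately show ?thesis
    using descent[OF k] by (simp add: energy_def algebra_simps)
qed

section \<open>Summable squared moves and bounded distances\<close>

lemma energy_bound: "energy (Suc n) + 1 / 2 * (\<Sum>k=1..n. (move k)\<^sup>2) \<le> energy 1"
proof (induction n)
  case (Suc n)
  then show ?case using energy_descent[of "Suc n"] by (simp add: add_divide_distrib)
qed simp

lemma dist_sq_le_energy: "(norm (x k - xs))\<^sup>2 \<le> energy k"
  using lam_pos[of k] ratio_pos[of k] F_nonneg[of "k - 1"] by (simp add: energy_def)

lemma sum_move_sq_le: "(\<Sum>k=1..n. (move k)\<^sup>2) \<le> 2 * energy 1"
proof -
  have "0 \<le> energy (Suc n)" using dist_sq_le_energy[of "Suc n"] by (rule order_trans[rotated]) simp
  then show ?thesis using energy_bound[of n] by simp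
qed

lemma dist_sq_le: "1 \<le> k \<Longrightarrow> (norm (x k - xs))\<^sup>2 \<le> energy 1"
proof -
  assume "1 \<le> k"
  then obtain n where n: "k = Suc n" by (cases k) auto
  have "0 \<le> (\<Sum>k=1..n. (move k)\<^sup>2)" by (intro sum_nonneg) simp
  then show ?thesis using energy_bound[of n] dist_sq_le_energy[of k] unfolding n by linarith
qed

text \<open>Smoothness is anchored at the new point \<open>x k\<close>, so that
  \<open>lam k * norm (g k)\<close> is the next move; hence the index shift in the shortfall
  sums.\<close>

lemma local_step_large:
  assumes k: "1 \<le> k" and loc: "lam k = local_step f x k"
  shows "1 \<le> 4 * lam k * (L0 + L1 * norm (g k))"
proof -
  have "norm (g (k - 1) - g k) \<le> (L0 + L1 * norm (g k)) * norm (x (k - 1) - x k)"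
    using asym_smooth unfolding asym_smooth_def by blast
  then have "4 * lam k * norm (g k - g (k - 1)) \<le> 4 * lam k * ((L0 + L1 * norm (g k)) * move k)"
    using lam_pos[of k] by (intro mult_left_mono) (auto simp: norm_minus_commute)
  moreover have "4 * lam k * norm (g k - g (k - 1)) = move k"
    using grad_neq[OF k] by (simp add: loc local_step_def)
  ultimately have "1 * move k \<le> 4 * lam k * (L0 + L1 * norm (g k)) * move k"
    by (simp add: mult.assoc)
  then show ?thesis using move_pos[OF k] by (simp only: mult_le_cancel_right_pos)
qed

section \<open>Shortfalls along a run\<close>

lemma capped_eq: "capped k = \<mu> / (8 * L0) * (1 - shortfall (8 * L0 * lam k))"
proof -
  define r where "r = \<mu> / (8 * L0)"
  have r: "0 < r" using mu_pos L0_pos by (simp add: r_def)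
  have lam: "lam k * \<mu> = r * (8 * L0 * lam k)" using L0_pos by (simp add: r_def)
  have "min (r * p) r = r * (1 - max 0 (1 - p))" for p
    using r by (cases "p \<le> 1") (simp_all add: min_absorb1 min_absorb2)
  then show ?thesis unfolding capped_def shortfall_def lam r_def[symmetric] .
qed

text \<open>The run lemma with \<open>p k = 8 * L0 * lam k\<close> and
  \<open>A k = L1 * move (Suc k)\<close>; the factor 2 is that of
  \<open>sum_move_sq_le\<close>.\<close>

lemma sum_shortfall_steps:
  assumes D: "0 < D" "D\<^sup>2 = energy 1"
    and M: "2 + log growth (real_of_int \<lceil>(1 + L1 * D) / 2\<rceil>) \<le> M" and n: "1 \<le> n"
  shows "(\<Sum>k=1..n. (shortfall (8 * L0 * lam k))\<^sup>2) \<le> M\<^sup>2 * (2 * (L1 * D)\<^sup>2)"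
proof -
  have "(\<Sum>k=1..n. (shortfall (8 * L0 * lam k))\<^sup>2)
      + pot (sqrt (1 + 3 / 4 * ratio n) * (8 * L0 * lam n))
      \<le> M\<^sup>2 * (\<Sum>k=1..n. (L1 * move (Suc k))\<^sup>2)"
  proof (rule sum_shortfall_sq_le[OF _ ratio_pos _ n])
    show "0 < 8 * L0 * lam k" for k using L0_pos lam_pos by simp
    fix k :: nat assume k: "1 \<le> k"
    show "2 - 8 * L0 * lam k \<le> 8 * (L1 * move (Suc k)) \<and> 2 - log growth (8 * L0 * lam k) \<le> M
      \<or> 2 \<le> k \<and> 8 * L0 * lam k = sqrt (1 + 3 / 4 * ratio (k - 1)) * (8 * L0 * lam (k - 1))
        \<and> 1 \<le> ratio k"
      using k
    proof (cases rule: lam_cases)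
      case 1
      note large = local_step_large[OF k 1]
      have "2 - 8 * L0 * lam k \<le> 8 * (L1 * move (Suc k))"
        using large unfolding move_eq by (simp add: algebra_simps)
      moreover have "2 - log growth (8 * L0 * lam k) \<le> M"
      proof -
        define C where "C = real_of_int \<lceil>(1 + L1 * D) / 2\<rceil>"
        have C: "(1 + L1 * D) / 2 \<le> C" by (simp add: C_def)
        have "0 < (1 + L1 * D) / 2" using L1_nonneg D by (simp add: add_pos_nonneg)
        then have C0: "0 < C" using C by (rule less_le_trans)
        \<comment> \<open>The gradient is then at most \<open>L0 * D\<close>, so a local step
          satisfies \<open>8 * L0 * lam k >= 1 / C\<close>.\<close>
        have "norm (x k - xs) \<le> D"
          by (rule power2_le_imp_le) (use dist_sq_le[OF k] D in simp_all)
        then have "L0 * norm (x k - xs) \<le> L0 * D" using L0_pos by simp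
        then have "norm (g k) \<le> L0 * D" using grad_le[of "x k"] by linarith
        then have "4 * lam k * (L0 + L1 * norm (g k)) \<le> 4 * lam k * (L0 + L1 * (L0 * D))"
          using lam_pos[of k] L1_nonneg by (intro mult_left_mono add_left_mono) auto
        also have "\<dots> = 8 * L0 * lam k * ((1 + L1 * D) / 2)" by (simp add: algebra_simps)
        also have "\<dots> \<le> 8 * L0 * lam k * C"
          using C L0_pos lam_pos[of k] by (intro mult_left_mono) auto
        finally have "1 \<le> 8 * L0 * lam k * C" using large by linarith
        moreover have pos: "0 < 8 * L0 * lam k" using L0_pos lam_pos[of k] by simp
        ultimately have "0 \<le> log growth (8 * L0 * lam k * C)"
          using zero_le_log_cancel_iff[OF growth_bounds(1) mult_pos_pos[OF pos C0]] by blast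
        also have "\<dots> = log growth (8 * L0 * lam k) + log growth C"
          by (rule log_mult_pos[OF pos C0])
        finally show ?thesis using M unfolding C_def by linarith
      qed
      ultimately show ?thesis by blast
    next
      case 2
      have "1 * lam (k - 1) \<le> sqrt (1 + 3 * ratio (k - 1) / 4) * lam (k - 1)"
        using ratio_pos[of "k - 1"] lam_pos[of "k - 1"] by (intro mult_right_mono) auto
      then have "1 \<le> ratio k" using 2(2) lam_pos[of "k - 1"] by (simp add: step_ratio_def)
      then show ?thesis using 2 by (simp add: mult_ac)
    qed
  qed
  moreover have "0 \<le> pot (sqrt (1 + 3 / 4 * ratio n) * (8 * L0 * lam n))"
    using L0_pos lam_pos ratio_pos[of n] by (intro pot_nonneg mult_pos_pos) (auto simp: add_pos_pos)
  moreover have "M\<^sup>2 * (\<Sum>k=1..n. (L1 * move (Suc k))\<^sup>2) \<le> M\<^sup>2 * (2 * (L1 * D)\<^sup>2)"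
  proof (rule mult_left_mono)
    have "(\<Sum>k=1..n. (move (Suc k))\<^sup>2) = (\<Sum>k=Suc 1..Suc n. (move k)\<^sup>2)"
      by (rule sum.shift_bounds_cl_Suc_ivl[symmetric])
    also have "\<dots> \<le> (\<Sum>k=1..Suc n. (move k)\<^sup>2)" by (rule sum_mono2) auto
    also have "\<dots> \<le> 2 * D\<^sup>2" using sum_move_sq_le[of "Suc n"] D by simp
    finally have "L1\<^sup>2 * (\<Sum>k=1..n. (move (Suc k))\<^sup>2) \<le> L1\<^sup>2 * (2 * D\<^sup>2)"
      by (rule mult_left_mono) simp
    then show "(\<Sum>k=1..n. (L1 * move (Suc k))\<^sup>2) \<le> 2 * (L1 * D)\<^sup>2"
      by (simp add: power_mult_distrib sum_distrib_left)
  qed simp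
  ultimately show ?thesis by linarith
qed

section \<open>The linear rate\<close>

lemma Psi_1_nonneg: "0 \<le> Psi f \<mu> L0 xs x lam 1"
  using lam_mu_le[of 1] lam_pos[of 1] ratio_pos[of 1] F_nonneg[of 0] alpha_star_bounds mu_pos L0_pos
  by (simp add: Psi_def)

text \<open>Any upper bound \<open>q\<close> of the mean contraction factor is allowed, so both
  forms of the rate follow.\<close>

lemma Psi_rate:
  assumes D: "0 < D" "D\<^sup>2 = energy 1"
    and M: "M = 2 + log growth (real_of_int \<lceil>(1 + L1 * D) / 2\<rceil>)" and N: "1 \<le> N"
    and q: "1 - alpha_star * \<mu> / (8 * L0) * (1 - sqrt (2 * real N) * M * L1 * D / real N) \<le> q"
  shows "Psi f \<mu> L0 xs x lam (N + 1) \<le> q ^ N * Psi f \<mu> L0 xs x lam 1"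
proof -
  define s d where "s = (\<lambda>k. shortfall (8 * L0 * lam k))"
    and "d = (\<lambda>k. 3 / 4 * s k + 1 / 4 * s (Suc k))"
  define r where "r = alpha_star * \<mu> / (8 * L0)"
  have r: "0 < r" "r \<le> 1"
  proof -
    show "0 < r" using alpha_star_bounds mu_pos L0_pos by (simp add: r_def)
    have "alpha_star * \<mu> \<le> 1 * (8 * L0)"
      using alpha_star_bounds mu_pos mu_le_L0 L0_pos by (intro mult_mono) auto
    then show "r \<le> 1" using L0_pos by (simp add: r_def)
  qed
  have s: "0 \<le> s k" "s k \<le> 1" for k
    using lam_pos[of k] L0_pos by (auto simp: s_def shortfall_def)
  have d: "0 \<le> d k" "d k \<le> 1" for k
    using s[of k] s[of "Suc k"] unfolding d_def by simp_all
  have step: "Psi f \<mu> L0 xs x lam (Suc k) \<le> (1 - r * (1 - d k)) * Psi f \<mu> L0 xs x lam k"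
    if "1 \<le> k" for k
  proof -
    have "alpha_star * (3 / 4 * capped k + 1 / 4 * capped (Suc k)) = r * (1 - d k)"
      unfolding capped_eq r_def d_def s_def
      by (simp add: algebra_simps add_divide_distrib diff_divide_distrib)
    then show ?thesis using Psi_contraction[OF that] by simp
  qed
  have fac: "0 \<le> 1 - r * (1 - d k)" for k
    using mult_mono[of r 1 "1 - d k" 1] r d[of k] by simp
  have "Psi f \<mu> L0 xs x lam (n + 1) \<le> (\<Prod>k=1..n. 1 - r * (1 - d k)) * Psi f \<mu> L0 xs x lam 1" for n
  proof (induction n)
    case (Suc n)
    have "Psi f \<mu> L0 xs x lam (Suc (n + 1)) \<le> (1 - r * (1 - d (n + 1))) * Psi f \<mu> L0 xs x lam (n + 1)"
      by (rule step) simp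
    also have "\<dots> \<le> (1 - r * (1 - d (n + 1))) *
        ((\<Prod>k=1..n. 1 - r * (1 - d k)) * Psi f \<mu> L0 xs x lam 1)"
      by (rule mult_left_mono[OF Suc fac])
    finally show ?case by (simp add: mult_ac)
  qed simp
  note prod_bound = this[of N]
  have M0: "0 \<le> M"
  proof -
    have "0 < (1 + L1 * D) / 2" using L1_nonneg D by (simp add: add_pos_nonneg)
    then have "0 < \<lceil>(1 + L1 * D) / 2\<rceil>" by (simp only: zero_less_ceiling)
    then have "1 \<le> real_of_int \<lceil>(1 + L1 * D) / 2\<rceil>" by linarith
    then show ?thesis using growth_bounds by (simp add: M)
  qed
  have sum_d: "(\<Sum>k=1..N. d k) \<le> sqrt (2 * real N) * M * L1 * D"
  proof (rule power2_le_imp_le)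
    have le: "(\<Sum>k=1..n. (s k)\<^sup>2) \<le> M\<^sup>2 * (2 * (L1 * D)\<^sup>2)" if "1 \<le> n" for n
      unfolding s_def using sum_shortfall_steps[OF D _ that] M by simp
    \<comment> \<open>The shifted sum reaches index \<open>N + 1\<close>; the bound
      \<open>le\<close> is uniform in the number of terms.\<close>
    have "(\<Sum>k=1..N. (s (Suc k))\<^sup>2) = (\<Sum>k=Suc 1..Suc N. (s k)\<^sup>2)"
      by (rule sum.shift_bounds_cl_Suc_ivl[symmetric])
    also have "\<dots> \<le> (\<Sum>k=1..Suc N. (s k)\<^sup>2)" by (rule sum_mono2) auto
    also have "\<dots> \<le> M\<^sup>2 * (2 * (L1 * D)\<^sup>2)" using le[of "Suc N"] by simp
    finally have le': "(\<Sum>k=1..N. (s (Suc k))\<^sup>2) \<le> M\<^sup>2 * (2 * (L1 * D)\<^sup>2)" .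
    \<comment> \<open>Convexity of the square: \<open>d k\<close> is a convex combination of two
      shortfalls.\<close>
    have "(d k)\<^sup>2 \<le> 3 / 4 * (s k)\<^sup>2 + 1 / 4 * (s (Suc k))\<^sup>2" for k
    proof -
      have "0 \<le> 3 / 16 * (s k - s (Suc k))\<^sup>2" by simp
      then show ?thesis by (simp add: d_def power2_eq_square algebra_simps)
    qed
    then have "(\<Sum>k=1..N. (d k)\<^sup>2) \<le> (\<Sum>k=1..N. 3 / 4 * (s k)\<^sup>2 + 1 / 4 * (s (Suc k))\<^sup>2)"
      by (rule sum_mono)
    also have "\<dots> = 3 / 4 * (\<Sum>k=1..N. (s k)\<^sup>2) + 1 / 4 * (\<Sum>k=1..N. (s (Suc k))\<^sup>2)"
      by (simp only: sum.distrib sum_distrib_left)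
    also have "\<dots> \<le> M\<^sup>2 * (2 * (L1 * D)\<^sup>2)" using le[OF N] le' by linarith
    finally have "(\<Sum>k=1..N. (d k)\<^sup>2) * real N \<le> M\<^sup>2 * (2 * (L1 * D)\<^sup>2) * real N"
      by (rule mult_right_mono) simp
    moreover have "(\<Sum>k=1..N. d k)\<^sup>2 \<le> (\<Sum>k=1..N. (d k)\<^sup>2) * real N"
      using sum_squared_le_sum_of_squares[of d "{1..N}"] by simp
    ultimately show "(\<Sum>k=1..N. d k)\<^sup>2 \<le> (sqrt (2 * real N) * M * L1 * D)\<^sup>2"
      by (simp add: power_mult_distrib mult_ac)
    show "0 \<le> sqrt (2 * real N) * M * L1 * D" using M0 L1_nonneg D by simp
  qed
  have "(\<Prod>k=1..N. 1 - r * (1 - d k)) \<le> ((\<Sum>k=1..N. 1 - r * (1 - d k)) / real N) ^ N"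
    using prod_le_mean_power[of "{1..N}" "\<lambda>k. 1 - r * (1 - d k)"] fac N by simp
  also have "\<dots> \<le> q ^ N"
  proof (rule power_mono)
    have "(\<Sum>k=1..N. 1 - r * (1 - d k)) = real N - r * (real N - (\<Sum>k=1..N. d k))"
      by (simp add: sum_subtractf flip: sum_distrib_left)
    then have "(\<Sum>k=1..N. 1 - r * (1 - d k)) / real N = 1 - r * (1 - (\<Sum>k=1..N. d k) / real N)"
      using N by (simp add: field_simps)
    also have "\<dots> \<le> 1 - r * (1 - sqrt (2 * real N) * M * L1 * D / real N)"
      using r sum_d N by (intro diff_left_mono mult_left_mono divide_right_mono) auto
    finally show "(\<Sum>k=1..N. 1 - r * (1 - d k)) / real N \<le> q" using q by (simp add: r_def)
    show "0 \<le> (\<Sum>k=1..N. 1 - r * (1 - d k)) / real N"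
      using fac by (intro divide_nonneg_nonneg sum_nonneg) auto
  qed
  finally show ?thesis
    using prod_bound mult_right_mono[OF _ Psi_1_nonneg] by (meson order_trans)
qed

end

theorem theoremG6:
  fixes f :: "real ^ 'd \<Rightarrow> real"
    and \<mu> L0 L1 D m :: real
    and xs :: "real ^ 'd"
    and x :: "nat \<Rightarrow> real ^ 'd"
    and lam :: "nat \<Rightarrow> real"
  assumes "\<forall>z. f differentiable (at z)"
    and "\<mu> > 0" and "strongly_convex \<mu> f"
    and "L0 > 0" and "L1 \<ge> 0" and "asym_smooth L0 L1 f"
    and "\<forall>z. f xs \<le> f z"
    and "adgd_run f x lam"
    and "D > 0"
    and "D\<^sup>2 = (norm (x 1 - xs))\<^sup>2 + 3 / 4 * (norm (x 1 - x 0))\<^sup>2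
               + 2 * lam 1 * step_ratio lam 1 * (f (x 0) - f xs)"
    and "m = 1 + log (sqrt (7 / 4)) (real_of_int \<lceil>(1 + L1 * D) / 2\<rceil>)"
  shows "(\<forall>N::nat. N \<ge> 1 \<and> real N > sqrt (2 * real N) * (m + 1) * L1 * D \<longrightarrow>
            Psi f \<mu> L0 xs x lam (N + 1)
              \<le> (1 - alpha_star * \<mu> / (8 * L0)
                   + alpha_star * \<mu> * (m + 1) * L1 * D / (4 * sqrt (2 * real N) * L0)) ^ N
                 * Psi f \<mu> L0 xs x lam 1)
       \<and> (\<forall>N::nat. N \<ge> 1 \<and> real N \<ge> 8 * (m + 1)\<^sup>2 * L1\<^sup>2 * D\<^sup>2 \<longrightarrow>
            Psi f \<mu> L0 xs x lam (N + 1)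
              \<le> (1 - alpha_star * \<mu> / (16 * L0)) ^ N * Psi f \<mu> L0 xs x lam 1)"
proof -
  interpret adgd f \<mu> L0 L1 xs x lam
    using assms by unfold_locales auto
  have E: "D\<^sup>2 = energy 1" using assms(10) by (simp add: energy_def)
  have M: "m + 1 = 2 + log growth (real_of_int \<lceil>(1 + L1 * D) / 2\<rceil>)"
    using assms(11) by simp
  note rate = Psi_rate[OF \<open>D > 0\<close> E M]
  show ?thesis
  proof (intro conjI allI impI; elim conjE)
    fix N :: nat assume N: "1 \<le> N"
    define w where "w = sqrt (2 * real N)"
    have w: "0 < w" "2 * real N = w * w" using N by (simp_all add: w_def)
    \<comment> \<open>Since \<open>2 * real N = w * w\<close>, the quotient
      \<open>w / real N\<close> becomes the \<open>2 / w\<close> of the statement.\<close>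
    have "w * (m + 1) * L1 * D / real N = 2 * w * (m + 1) * L1 * D / (2 * real N)" by simp
    also have "\<dots> = 2 * (m + 1) * L1 * D / w" unfolding w(2) using w(1) by simp
    finally have eq: "w * (m + 1) * L1 * D / real N = 2 * (m + 1) * L1 * D / w" .
    have "1 - alpha_star * \<mu> / (8 * L0) * (1 - w * (m + 1) * L1 * D / real N)
        = 1 - alpha_star * \<mu> / (8 * L0) + alpha_star * \<mu> * (m + 1) * L1 * D / (4 * w * L0)"
      unfolding eq using L0_pos w(1) by (simp add: field_simps)
    then have "1 - alpha_star * \<mu> / (8 * L0) * (1 - sqrt (2 * real N) * (m + 1) * L1 * D / real N)
        \<le> 1 - alpha_star * \<mu> / (8 * L0)
          + alpha_star * \<mu> * (m + 1) * L1 * D / (4 * sqrt (2 * real N) * L0)"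
      by (simp add: w_def)
    then show "Psi f \<mu> L0 xs x lam (N + 1)
        \<le> (1 - alpha_star * \<mu> / (8 * L0)
             + alpha_star * \<mu> * (m + 1) * L1 * D / (4 * sqrt (2 * real N) * L0)) ^ N
           * Psi f \<mu> L0 xs x lam 1"
      by (rule rate[OF N])
  next
    fix N :: nat assume N: "1 \<le> N" and large: "8 * (m + 1)\<^sup>2 * L1\<^sup>2 * D\<^sup>2 \<le> real N"
    \<comment> \<open>Squared, this is the hypothesis times \<open>real N / 4\<close>; it makes the
      bound on the mean shortfall at most 1/2.\<close>
    have "sqrt (2 * real N) * (m + 1) * L1 * D \<le> real N / 2"
    proof (rule power2_le_imp_le)
      have "(8 * (m + 1)\<^sup>2 * L1\<^sup>2 * D\<^sup>2) * (real N / 4) \<le> real N * (real N / 4)"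
        using large by (rule mult_right_mono) simp
      then show "(sqrt (2 * real N) * (m + 1) * L1 * D)\<^sup>2 \<le> (real N / 2)\<^sup>2"
        by (simp add: power_mult_distrib power_divide power2_eq_square[of "real N"] mult_ac)
    qed simp
    then have "1 / 2 \<le> 1 - sqrt (2 * real N) * (m + 1) * L1 * D / real N"
      using N by (simp add: field_simps)
    then have "alpha_star * \<mu> / (8 * L0) * (1 / 2)
        \<le> alpha_star * \<mu> / (8 * L0) * (1 - sqrt (2 * real N) * (m + 1) * L1 * D / real N)"
      using alpha_star_bounds mu_pos L0_pos by (intro mult_left_mono) auto
    then have "1 - alpha_star * \<mu> / (8 * L0) * (1 - sqrt (2 * real N) * (m + 1) * L1 * D / real N)
        \<le> 1 - alpha_star * \<mu> / (16 * L0)"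
      by simp
    then show "Psi f \<mu> L0 xs x lam (N + 1)
        \<le> (1 - alpha_star * \<mu> / (16 * L0)) ^ N * Psi f \<mu> L0 xs x lam 1"
      by (rule rate[OF N])
  qed
qed

end
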